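(* Let $p$ be an odd prime, $\chi$ a Dirichlet character modulo $p^v$ with $v\ge1$, $x\in\mathbb Z_p$, and $s\in\mathbb C_p$ with $|s|_p<R_p=p^{(p-2)/(p-1)}$. (1) $\zeta_{p,E}(\chi,s,x+1)+\zeta_{p,E}(\chi,s,x)=2\chi(x)\langle x\rangle^{1-s}$ (the right side being $0$ when $p\mid x$). (2) $\zeta_{p,E}(\chi,s,1-x)=\chi(-1)\,\zeta_{p,E}(\chi,s,x)$. (3) Put $\ell_{p,E}(\chi,s)=\zeta_{p,E}(\chi,s,0)$. If $\chi$ is even ($\chi(-1)=1$), then $\ell_{p,E}(\chi,s)=0$; and for every positive integer $n$, $$\zeta_{p,E}(\chi,s,n)=\chi(-1)\Big(2\sum_{j=1}^{n-1}\langle j-n\rangle^{1-s}\chi(j-n)(-1)^{j+1}+(-1)^{n+1}\ell_{p,E}(\chi,s)\Big),$$ where terms with $\chi(j-n)=0$ are $0$. (4) If $N$ is an odd positive integer with $p\nmid N$, then $$\sum_{i=0}^{N-1}\zeta_{p,E}\Big(\chi,s,x+\frac iN\Big)(-1)^i=\chi^{-1}(N)\,\zeta_{p,E}(\chi,s,Nx).$$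
   Context: $p$ is an odd prime. For $f:\mathbb Z_p\to\mathbb C_p$ uniformly differentiable, $\int_{\mathbb Z_p}f(a)\,d\mu_{-1}(a)=\lim_{N\to\infty}\sum_{a=0}^{p^N-1}(-1)^af(a)$. For $y\in\mathbb Z_p^\times$, $\omega(y)$ is the $(p-1)$-th root of unity with $\omega(y)\equiv y\pmod p$ and $\langle y\rangle=y/\omega(y)$; $\langle y\rangle^t=\sum_{k\ge0}\binom tk(\langle y\rangle-1)^k$ for $|t|_p<R_p$. A Dirichlet character $\chi$ modulo $p^v$ is extended to $\mathbb Z_p$ by $\chi(y)=\chi(n)$ for any integer $n\equiv y\pmod{p^v}$ (so $\chi(y)=0$ if $p\mid y$). For $x\in\mathbb Z_p$, $\zeta_{p,E}(\chi,s,x)=\int_{\mathbb Z_p}\chi(x+a)\langle x+a\rangle^{1-s}\,d\mu_{-1}(a)$, the integrand being $0$ where $\chi(x+a)=0$.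
   Formalization: In (4) the right side is corrected to χ^{-1}(N)⟨N⟩^{s-1}ζ_{p,E}(χ,s,Nx), because the relation as printed fails: for p=3, χ the odd character mod 3, s=0, x=0, N=5 the left side is 1/5 and the printed right side is -1. *)

theory Defs
  imports "HOL-Analysis.Analysis" "HOL-Computational_Algebra.Computational_Algebra"
begin

text \<open>
  The field of complex \<open>p\<close>-adic numbers is not constructed here but specified: it is a type whose
  metric is induced by an absolute value, with the absolute value written as the distance to \<open>0\<close>.
\<close>

abbreviation padic_abs :: "'a::{field_char_0,metric_space} \<Rightarrow> real"
  where "padic_abs x \<equiv> dist x 0"

text \<open>
  Topological closures of \<open>\<int>\<close> and \<open>\<rat>\<close>. Inside a complete field with the \<open>p\<close>-adic absolute value on
  the rationals these are the copies of the \<open>p\<close>-adic integers and of the \<open>p\<close>-adic numbers.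
\<close>

definition padic_ints :: "'a::{field_char_0,metric_space} set"
  where "padic_ints = closure (range of_int)"

definition padic_numbers :: "'a::{field_char_0,metric_space} set"
  where "padic_numbers = closure (range of_rat)"

text \<open>
  \<open>'a\<close> is the completion of an algebraic closure of the field of \<open>p\<close>-adic numbers. Since \<open>'a\<close> is
  algebraically closed, its elements that are algebraic over \<open>padic_numbers\<close> form an algebraic
  closure of \<open>padic_numbers\<close>; by the last conjunct this closure is dense, and completeness of \<open>'a\<close>
  is part of the class \<open>complete_space\<close>. These conditions determine \<open>'a\<close> up to isometric
  isomorphism.
\<close>

definition is_complex_padic ::
    "nat \<Rightarrow> 'a::{field_char_0,alg_closed_field,complete_space} itself \<Rightarrow> bool"
  where "is_complex_padic p T \<longleftrightarrow>
    (\<forall>x y::'a. dist x y = padic_abs (x - y)) \<and>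
    (\<forall>x y::'a. padic_abs (x * y) = padic_abs x * padic_abs y) \<and>
    (\<forall>x y::'a. padic_abs (x + y) \<le> max (padic_abs x) (padic_abs y)) \<and>
    padic_abs (of_nat p :: 'a) = 1 / real p \<and>
    closure {x::'a. \<exists>P. P \<noteq> 0 \<and> (\<forall>i. coeff P i \<in> padic_numbers) \<and> poly P x = 0} = UNIV"

definition padic_cong :: "'a::{field_char_0,metric_space} \<Rightarrow> 'a \<Rightarrow> nat \<Rightarrow> bool"
  where "padic_cong x y m \<longleftrightarrow> (\<exists>z\<in>padic_ints. x - y = of_nat m * z)"

definition teichmueller :: "nat \<Rightarrow> 'a::{field_char_0,metric_space} \<Rightarrow> 'a"
  where "teichmueller p y = (THE w. w ^ (p - 1) = 1 \<and> padic_cong w y p)"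

definition padic_angle :: "nat \<Rightarrow> 'a::{field_char_0,metric_space} \<Rightarrow> 'a"
  where "padic_angle p y = y / teichmueller p y"

text \<open>The power \<open>\<langle>y\<rangle>\<^sup>t\<close>; meaningful for \<open>p\<close>-adic units \<open>y\<close> and \<open>|t|\<close> below \<open>padic_radius p\<close>.\<close>

definition angle_power :: "nat \<Rightarrow> 'a::{field_char_0,metric_space} \<Rightarrow> 'a \<Rightarrow> 'a"
  where "angle_power p y t = (\<Sum>k. (t gchoose k) * (padic_angle p y - 1) ^ k)"

definition padic_radius :: "nat \<Rightarrow> real"
  where "padic_radius p = real p powr ((real p - 2) / (real p - 1))"

definition dirichlet_character :: "nat \<Rightarrow> (int \<Rightarrow> 'a::field) \<Rightarrow> bool"
  where "dirichlet_character m chi \<longleftrightarrow>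
    (\<forall>a. chi (a + int m) = chi a) \<and>
    (\<forall>a b. chi (a * b) = chi a * chi b) \<and>
    chi 1 = 1 \<and>
    (\<forall>a. chi a = 0 \<longleftrightarrow> \<not> coprime a (int m))"

text \<open>
  The extension of a character modulo \<open>m\<close> (a power of \<open>p\<close>) to the \<open>p\<close>-adic integers; by periodicity
  the value does not depend on the integer that is chosen.
\<close>

definition character_ext ::
    "nat \<Rightarrow> (int \<Rightarrow> 'a) \<Rightarrow> 'a::{field_char_0,metric_space} \<Rightarrow> 'a"
  where "character_ext m chi y = chi (SOME n. padic_cong y (of_int n) m)"

text \<open>
  The integral over the \<open>p\<close>-adic integers against \<open>\<mu>\<^sub>-\<^sub>1\<close>. It only uses the values of \<open>f\<close> at natural
  numbers and, \<open>lim\<close> being total, is unspecified where the limit does not exist.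
\<close>

definition fermionic_integral ::
    "nat \<Rightarrow> ('a \<Rightarrow> 'a) \<Rightarrow> 'a::{field_char_0,metric_space}"
  where "fermionic_integral p f = lim (\<lambda>N. \<Sum>a<p ^ N. (-1) ^ a * f (of_nat a))"

text \<open>
  Where \<open>character_ext\<close> vanishes, so does the product below, whatever \<open>angle_power\<close> returns there.
\<close>

definition zeta_pE ::
    "nat \<Rightarrow> nat \<Rightarrow> (int \<Rightarrow> 'a) \<Rightarrow> 'a \<Rightarrow> 'a \<Rightarrow> 'a::{field_char_0,metric_space}"
  where "zeta_pE p v chi s x =
    fermionic_integral p (\<lambda>a. character_ext (p ^ v) chi (x + a) * angle_power p (x + a) (1 - s))"

definition ell_pE ::
    "nat \<Rightarrow> nat \<Rightarrow> (int \<Rightarrow> 'a) \<Rightarrow> 'a \<Rightarrow> 'a::{field_char_0,metric_space}"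
  where "ell_pE p v chi s = zeta_pE p v chi s 0"

text \<open>
  Pitfall in the distribution relation for \<open>\<Sum>i<N. (-1) ^ i * zeta_pE p v chi s (x + i / N)\<close>: pulling
  \<open>1 / N\<close> out of the argument of \<open>\<langle>x + i / N + a\<rangle>\<close> leaves the factor \<open>angle_power p N (s - 1)\<close>, besides
  \<open>inverse (chi N)\<close>. This factor is sometimes omitted in print, but the relation is false
  without it: for \<open>p = 3\<close>, \<open>chi\<close> the odd character modulo \<open>3\<close>, \<open>s = 0\<close>, \<open>x = 0\<close>, \<open>N = 5\<close>, the sum is
  \<open>1 / 5\<close>, while \<open>inverse (chi 5) * zeta_pE 3 1 chi 0 0 = -1\<close>.
\<close>

end

theory Submission
  imports Defs "HOL-Number_Theory.Residues"
begin

text \<open>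
  For a function \<open>f\<close> on the \<open>p\<close>-adic integers with \<open>|f y - f y'| \<le> C |y - y'|\<close> and an odd number \<open>r\<close>,
  splitting a sum of length \<open>r p\<^sup>M\<close> into \<open>r\<close> blocks and using \<open>\<Sum>d<r. (-1)\<^sup>d = 1\<close> shows that
  \<open>\<Sum>a<r p\<^sup>M. (-1)\<^sup>a f (x + a)\<close> and \<open>\<Sum>a<p\<^sup>M. (-1)\<^sup>a f (x + a)\<close> differ by at most \<open>C / p\<^sup>M\<close>. With \<open>r = p\<close>
  this gives the existence of the fermionic integral. The functional equations then follow on the
  level of finite sums: telescoping for the shift, reversal of the summation for the reflection, and
  writing \<open>b = i + N a\<close> for the distribution relation, where the sum of length \<open>N p\<^sup>M\<close> is again
  handled by the block estimate.

  The integrand \<open>\<chi>(y) \<langle>y\<rangle>\<^sup>t\<close> is Lipschitz because \<open>\<chi>\<close> is locally constant and the binomial series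
  converges geometrically, \<open>|t gchoose k| \<le> (M p\<^sup>1\<^sup>/\<^sup>(\<^sup>p\<^sup>-\<^sup>1\<^sup>))\<^sup>k\<close> for \<open>|t| \<le> M\<close>, \<open>M \<ge> 1\<close>. It is multiplicative
  because the coefficients of \<open>(1 + u T)\<^sup>t (1 + w T)\<^sup>t = (1 + (u + w) T + u w T\<^sup>2)\<^sup>t\<close> agree for natural \<open>t\<close>
  and are polynomials in \<open>t\<close>.
\<close>

hide_const (open) up_ring.coeff up_ring.monom module.smult

section \<open>Fields with a \<open>p\<close>-adic absolute value\<close>

locale padic_valued_field =
  fixes p :: nat and ty :: "'a::{field_char_0,complete_space} itself"
  assumes prime_p: "prime p"
    and dist_pabs: "\<And>x y::'a. dist x y = padic_abs (x - y)"
    and pabs_mult: "\<And>x y::'a. padic_abs (x * y) = padic_abs x * padic_abs y"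
    and pabs_add: "\<And>x y::'a. padic_abs (x + y) \<le> max (padic_abs x) (padic_abs y)"
    and pabs_p: "padic_abs (of_nat p :: 'a) = 1 / real p"
begin

lemma p_gt_1: "real p > 1"
  using prime_gt_1_nat[OF prime_p] by simp

lemma pabs_1 [simp]: "padic_abs (1::'a) = 1"
  using pabs_mult[of 1 1] by auto

lemma pabs_power: "padic_abs ((x::'a) ^ n) = padic_abs x ^ n"
  by (induction n) (auto simp: pabs_mult)

lemma pabs_prod: "padic_abs (prod f A :: 'a) = (\<Prod>i\<in>A. padic_abs (f i))"
  by (induction A rule: infinite_finite_induct) (auto simp: pabs_mult)

lemma pabs_uminus [simp]: "padic_abs (- x :: 'a) = padic_abs x"
proof -
  have "padic_abs (-1::'a) ^ 2 = 1"
    by (simp flip: pabs_power)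
  then have "padic_abs (-1::'a) = 1"
    by (simp add: power2_eq_1_iff) (metis zero_le_dist neg_0_le_iff_le not_one_le_zero)
  then show ?thesis
    using pabs_mult[of "-1" x] by simp
qed

lemma pabs_diff: "padic_abs (x - y :: 'a) \<le> max (padic_abs x) (padic_abs y)"
  using pabs_add[of x "-y"] by simp

lemma pabs_minus_commute: "padic_abs (x - y :: 'a) = padic_abs (y - x)"
  using pabs_uminus[of "x - y"] by simp

lemma pabs_diff_trans:
  assumes "padic_abs (x - y :: 'a) \<le> B" "padic_abs (y - z) \<le> B"
  shows "padic_abs (x - z) \<le> B"
  using pabs_add[of "x - y" "y - z"] assms by simp

lemma pabs_inverse: "padic_abs (inverse x :: 'a) = inverse (padic_abs x)"
proof (cases "x = 0")
  case False
  then have "padic_abs (inverse x) * padic_abs x = 1"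
    by (simp flip: pabs_mult)
  then show ?thesis
    by (metis inverse_unique inverse_inverse_eq)
qed auto

lemma pabs_divide: "padic_abs (x / y :: 'a) = padic_abs x / padic_abs y"
  by (simp add: divide_inverse pabs_mult pabs_inverse)

lemma pabs_sum:
  assumes "\<And>i. i \<in> A \<Longrightarrow> padic_abs (f i :: 'a) \<le> B" "B \<ge> 0"
  shows "padic_abs (sum f A) \<le> B"
  using assms
proof (induction A rule: infinite_finite_induct)
  case (insert x F)
  then have "padic_abs (f x) \<le> B" "padic_abs (sum f F) \<le> B"
    by auto
  then show ?case
    using pabs_add[of "f x" "sum f F"] insert.hyps by simp
qed auto

lemma pabs_of_nat: "padic_abs (of_nat n :: 'a) \<le> 1"
proof (induction n)
  case (Suc n)
  then show ?case
    using pabs_add[of 1 "of_nat n"] by simp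
qed auto

lemma pabs_of_int: "padic_abs (of_int n :: 'a) \<le> 1"
  by (cases n rule: int_cases2) (auto simp: pabs_of_nat)

lemma pabs_p_power: "padic_abs (of_nat p ^ k :: 'a) = 1 / real p ^ k"
  by (simp add: pabs_power pabs_p power_one_over)

text \<open>In a Bezout relation \<open>u * n + w * p = 1\<close> the second term has absolute value
  below 1. By the ultrametric inequality the first must then reach 1, which with
  \<open>|u| \<le> 1\<close> leaves no room for \<open>|n| < 1\<close>.\<close>

lemma pabs_of_int_coprime:
  assumes "\<not> int p dvd n"
  shows "padic_abs (of_int n :: 'a) = 1"
proof -
  have "coprime (int p) n"
    using assms prime_p by (simp add: prime_imp_coprime)
  then obtain u w where "u * n + w * int p = 1"
    using bezout_int[of n "int p"] by (auto simp: coprime_commute)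
  then have eq: "of_int u * of_int n + of_int w * of_nat p = (1::'a)"
    by (metis of_int_1 of_int_add of_int_mult of_int_of_nat_eq)
  have "padic_abs (of_int w * of_nat p :: 'a) \<le> 1 / real p"
    using mult_right_mono[OF pabs_of_int[of w], of "1 / real p"] by (simp add: pabs_mult pabs_p)
  moreover have "1 / real p < 1"
    using p_gt_1 by simp
  ultimately have "padic_abs (of_int u * of_int n :: 'a) \<ge> 1"
    using pabs_add[of "of_int u * of_int n" "of_int w * of_nat p"] unfolding eq by simp
  then have "padic_abs (of_int n :: 'a) \<ge> 1"
    using mult_right_mono[OF pabs_of_int[of u], of "padic_abs (of_int n :: 'a)"]
    by (simp add: pabs_mult)
  then show ?thesis
    using pabs_of_int[of n] by simp
qed

lemma pabs_of_nat_coprime: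
  assumes "\<not> p dvd n"
  shows "padic_abs (of_nat n :: 'a) = 1"
  using pabs_of_int_coprime[of "int n"] assms by simp

text \<open>Translates between size and divisibility for integers. The induction strips off one
  factor \<open>p\<close> at a time: once \<open>p ^ k\<close> is divided out, a cofactor of
  absolute value at most \<open>1 / p\<close> cannot be prime to \<open>p\<close>.\<close>

lemma pabs_of_int_le_iff:
  "padic_abs (of_int n :: 'a) \<le> 1 / real p ^ k \<longleftrightarrow> int (p ^ k) dvd n"
proof
  assume "int (p ^ k) dvd n"
  then obtain m where "n = int (p ^ k) * m" ..
  then have "padic_abs (of_int n :: 'a) = 1 / real p ^ k * padic_abs (of_int m :: 'a)"
    by (simp add: pabs_mult pabs_p_power)
  also have "\<dots> \<le> 1 / real p ^ k"
    using pabs_of_int[of m] p_gt_1 by (simp add: divide_right_mono)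
  finally show "padic_abs (of_int n :: 'a) \<le> 1 / real p ^ k" .
next
  assume "padic_abs (of_int n :: 'a) \<le> 1 / real p ^ k"
  then show "int (p ^ k) dvd n"
  proof (induction k)
    case (Suc k)
    have "1 / real p ^ Suc k \<le> 1 / real p ^ k"
      using p_gt_1 by (simp add: field_simps)
    then have "int (p ^ k) dvd n"
      using Suc by linarith
    then obtain m where m: "n = int (p ^ k) * m" ..
    then have "padic_abs (of_int n :: 'a) = 1 / real p ^ k * padic_abs (of_int m :: 'a)"
      by (simp add: pabs_mult pabs_p_power)
    then have "padic_abs (of_int m :: 'a) \<le> 1 / real p"
      using Suc.prems p_gt_1 by (simp add: field_simps)
    then have "padic_abs (of_int m :: 'a) \<noteq> 1"
      using p_gt_1 by auto
    then have "int p dvd m"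
      using pabs_of_int_coprime by blast
    then show ?case
      by (auto simp: m)
  qed auto
qed

lemma inverse_p_power_lt:
  assumes "e > 0"
  obtains k where "1 / real p ^ k < e"
proof -
  have "\<exists>k. (1 / real p) ^ k < e"
    using p_gt_1 assms by (intro real_arch_pow_inv) auto
  then show ?thesis
    using that by (auto simp: power_one_over)
qed

section \<open>The ring of p-adic integers and its congruences\<close>

lemma padic_intsI:
  assumes "\<And>k. \<exists>n. padic_abs (x - of_int n :: 'a) \<le> 1 / real p ^ k"
  shows "x \<in> padic_ints"
  unfolding padic_ints_def closure_approachable
proof (intro allI impI)
  fix e :: real assume "e > 0"
  then obtain k where "1 / real p ^ k < e"
    by (rule inverse_p_power_lt)
  moreover obtain n where "padic_abs (x - of_int n) \<le> 1 / real p ^ k"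
    using assms by blast
  ultimately show "\<exists>y\<in>range of_int. dist y x < e"
    by (auto intro!: exI[of _ n] simp: dist_pabs[of _ x] pabs_minus_commute)
qed

lemma padic_ints_approx:
  assumes "(x::'a) \<in> padic_ints"
  obtains n where "padic_abs (x - of_int n) \<le> 1 / real p ^ k"
proof -
  have "1 / real p ^ k > 0"
    using p_gt_1 by simp
  then obtain y where "y \<in> range of_int" "dist y x < 1 / real p ^ k"
    using assms unfolding padic_ints_def closure_approachable by blast
  then obtain n where "padic_abs (x - of_int n) < 1 / real p ^ k"
    by (auto simp: dist_pabs[of _ x] pabs_minus_commute)
  then show ?thesis
    using that[of n] by simp
qed

lemma of_int_padic_ints [simp]: "(of_int n :: 'a) \<in> padic_ints"
  by (rule padic_intsI) (use p_gt_1 in \<open>auto intro!: exI[of _ n]\<close>)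

lemma of_nat_padic_ints [simp]: "(of_nat n :: 'a) \<in> padic_ints"
  using of_int_padic_ints[of "int n"] by simp

lemma padic_ints_0 [simp]: "(0 :: 'a) \<in> padic_ints"
  and padic_ints_1 [simp]: "(1 :: 'a) \<in> padic_ints"
  using of_int_padic_ints[of 0] of_int_padic_ints[of 1] by simp_all

lemma pabs_padic_ints:
  assumes "(x::'a) \<in> padic_ints"
  shows "padic_abs x \<le> 1"
proof -
  obtain n where "padic_abs (x - of_int n) \<le> 1 / real p ^ 0"
    using assms by (rule padic_ints_approx)
  then show ?thesis
    using pabs_add[of "x - of_int n" "of_int n"] pabs_of_int[of n] by simp
qed

lemma padic_ints_add:
  assumes "(x::'a) \<in> padic_ints" "y \<in> padic_ints"
  shows "x + y \<in> padic_ints"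
proof (rule padic_intsI)
  fix k
  obtain m where "padic_abs (x - of_int m) \<le> 1 / real p ^ k"
    using assms(1) by (rule padic_ints_approx)
  moreover obtain n where "padic_abs (y - of_int n) \<le> 1 / real p ^ k"
    using assms(2) by (rule padic_ints_approx)
  ultimately have "padic_abs (x + y - of_int (m + n)) \<le> 1 / real p ^ k"
    using pabs_add[of "x - of_int m" "y - of_int n"] by (simp add: algebra_simps)
  then show "\<exists>n. padic_abs (x + y - of_int n) \<le> 1 / real p ^ k" ..
qed

lemma padic_ints_mult:
  assumes "(x::'a) \<in> padic_ints" "y \<in> padic_ints"
  shows "x * y \<in> padic_ints"
proof (rule padic_intsI)
  fix k
  obtain m where m: "padic_abs (x - of_int m) \<le> 1 / real p ^ k"
    using assms(1) by (rule padic_ints_approx)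
  obtain n where n: "padic_abs (y - of_int n) \<le> 1 / real p ^ k"
    using assms(2) by (rule padic_ints_approx)
  have "padic_abs ((x - of_int m) * y) \<le> 1 / real p ^ k"
    using mult_mono[OF m pabs_padic_ints[OF assms(2)]] p_gt_1 by (simp add: pabs_mult)
  moreover have "padic_abs (of_int m * (y - of_int n)) \<le> 1 / real p ^ k"
    using mult_mono[OF pabs_of_int[of m] n] p_gt_1 by (simp add: pabs_mult)
  ultimately have "padic_abs (x * y - of_int (m * n)) \<le> 1 / real p ^ k"
    using pabs_add[of "(x - of_int m) * y" "of_int m * (y - of_int n)"] by (simp add: algebra_simps)
  then show "\<exists>n. padic_abs (x * y - of_int n) \<le> 1 / real p ^ k" ..
qed

lemma padic_ints_uminus:
  assumes "(x::'a) \<in> padic_ints"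
  shows "- x \<in> padic_ints"
  using padic_ints_mult[OF of_int_padic_ints[of "-1"] assms] by simp

lemma padic_ints_diff:
  assumes "(x::'a) \<in> padic_ints" "y \<in> padic_ints"
  shows "x - y \<in> padic_ints"
  using padic_ints_add[OF assms(1) padic_ints_uminus[OF assms(2)]] by simp

lemma padic_ints_power:
  assumes "(x::'a) \<in> padic_ints"
  shows "x ^ n \<in> padic_ints"
  by (induction n) (auto intro: padic_ints_mult assms)

text \<open>An integer \<open>n\<close> that approximates \<open>x\<close> to precision
  \<open>k + j\<close> is itself of size at most \<open>1 / p ^ k\<close>, hence divisible by
  \<open>p ^ k\<close>, and the quotient approximates \<open>x / p ^ k\<close> to precision
  \<open>j\<close>. This makes congruence modulo \<open>p ^ k\<close> the same as closeness.\<close>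

lemma padic_ints_divide_p_power:
  assumes "(x::'a) \<in> padic_ints" "padic_abs x \<le> 1 / real p ^ k"
  shows "x / of_nat p ^ k \<in> padic_ints"
proof (rule padic_intsI)
  fix j
  have p0: "of_nat p \<noteq> (0::'a)"
    using p_gt_1 by auto
  obtain n where n: "padic_abs (x - of_int n) \<le> 1 / real p ^ (k + j)"
    using assms(1) by (rule padic_ints_approx)
  also have "\<dots> \<le> 1 / real p ^ k"
    using p_gt_1 by (simp add: field_simps power_add)
  finally have "padic_abs (of_int n :: 'a) \<le> 1 / real p ^ k"
    using pabs_diff[of x "x - of_int n"] assms(2) by simp
  then obtain m where m: "n = int (p ^ k) * m"
    unfolding pabs_of_int_le_iff ..
  have "x / of_nat p ^ k - of_int m = (x - of_int n) / of_nat p ^ k"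
    using p0 by (simp add: m field_simps)
  then have "padic_abs (x / of_nat p ^ k - of_int m) = padic_abs (x - of_int n) * real p ^ k"
    by (simp add: pabs_divide pabs_p_power)
  also have "\<dots> \<le> 1 / real p ^ j"
    using mult_right_mono[OF n, of "real p ^ k"] p_gt_1 by (simp add: power_add)
  finally show "\<exists>n. padic_abs (x / of_nat p ^ k - of_int n) \<le> 1 / real p ^ j" ..
qed

lemma padic_cong_iff_pabs:
  assumes "(x::'a) \<in> padic_ints" "y \<in> padic_ints"
  shows "padic_cong x y (p ^ k) \<longleftrightarrow> padic_abs (x - y) \<le> 1 / real p ^ k"
proof
  assume "padic_cong x y (p ^ k)"
  then obtain z where z: "z \<in> padic_ints" "x - y = of_nat (p ^ k) * z"
    unfolding padic_cong_def by blast
  then show "padic_abs (x - y) \<le> 1 / real p ^ k"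
    using pabs_padic_ints[OF z(1)] p_gt_1 by (simp add: pabs_mult pabs_p_power divide_right_mono)
next
  assume "padic_abs (x - y) \<le> 1 / real p ^ k"
  then have "(x - y) / of_nat p ^ k \<in> padic_ints"
    using assms by (intro padic_ints_divide_p_power padic_ints_diff)
  moreover have "of_nat p \<noteq> (0::'a)"
    using p_gt_1 by auto
  ultimately show "padic_cong x y (p ^ k)"
    unfolding padic_cong_def by (intro bexI[of _ "(x - y) / of_nat p ^ k"]) auto
qed

text \<open>The inverses of \<open>N\<close> modulo the powers \<open>p ^ k\<close>, obtained from
  Bezout, are integers that converge to \<open>1 / N\<close>.\<close>

lemma inverse_of_nat_padic_ints:
  assumes "\<not> p dvd N"
  shows "inverse (of_nat N :: 'a) \<in> padic_ints"
proof (rule padic_intsI)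
  fix k
  have "coprime (int N) (int (p ^ k))"
    using assms prime_p prime_imp_coprime[of p N] by (auto simp: coprime_commute)
  then obtain u w where "u * int N + w * int (p ^ k) = 1"
    using bezout_int[of "int N" "int (p ^ k)"] by auto
  then have "of_int (u * int N + w * int (p ^ k)) = (1::'a)"
    by simp
  then have eq: "of_int w * of_nat p ^ k = 1 - of_int u * (of_nat N :: 'a)"
    by (simp add: algebra_simps)
  have N: "of_nat N \<noteq> (0::'a)"
    using assms by (metis dvd_0_right of_nat_eq_0_iff)
  then have "inverse (of_nat N) - of_int u = (of_int w * of_nat p ^ k) / (of_nat N :: 'a)"
    unfolding eq by (simp add: field_simps)
  then have "padic_abs (inverse (of_nat N) - of_int u :: 'a) = padic_abs (of_int w :: 'a) * (1 / real p ^ k)"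
    by (simp add: pabs_divide pabs_mult pabs_p_power pabs_of_nat_coprime assms)
  also have "\<dots> \<le> 1 / real p ^ k"
    using mult_right_mono[OF pabs_of_int[of w], of "1 / real p ^ k"] p_gt_1 by simp
  finally show "\<exists>n. padic_abs (inverse (of_nat N) - of_int n :: 'a) \<le> 1 / real p ^ k" ..
qed

end

context padic_valued_field
begin

subsection \<open>Limits\<close>

text \<open>Metric and arithmetic are linked only through the absolute value, so the limit rules
  below are all reduced to real null sequences.\<close>

lemma tendsto_pabs_iff:
  fixes X :: "nat \<Rightarrow> 'a"
  shows "X \<longlonglongrightarrow> L \<longleftrightarrow> (\<lambda>n. padic_abs (X n - L)) \<longlonglongrightarrow> 0"
  by (simp only: tendsto_dist_iff[of X L] dist_pabs[of _ L])

lemma tendsto_pabsI: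
  fixes X :: "nat \<Rightarrow> 'a"
  assumes "\<And>n. padic_abs (X n - L) \<le> B n" "B \<longlonglongrightarrow> 0"
  shows "X \<longlonglongrightarrow> L"
  unfolding tendsto_pabs_iff
  by (rule tendsto_sandwich[OF _ _ tendsto_const assms(2)]) (use assms(1) in auto)

lemma tendsto_padic_perturb:
  fixes X :: "nat \<Rightarrow> 'a"
  assumes X: "X \<longlonglongrightarrow> L" and Y: "\<And>n. padic_abs (Y n - X n) \<le> B n" "B \<longlonglongrightarrow> 0"
  shows "Y \<longlonglongrightarrow> L"
proof (rule tendsto_pabsI)
  show "padic_abs (Y n - L) \<le> B n + padic_abs (X n - L)" for n
  proof -
    have "padic_abs (Y n - L) \<le> max (padic_abs (Y n - X n)) (padic_abs (X n - L))"
      using pabs_add[of "Y n - X n" "X n - L"] by simp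
    then show ?thesis
      using Y(1)[of n] zero_le_dist[of "Y n - X n" 0] zero_le_dist[of "X n - L" 0] by linarith
  qed
  show "(\<lambda>n. B n + padic_abs (X n - L)) \<longlonglongrightarrow> 0"
    using tendsto_add[OF Y(2) X[unfolded tendsto_pabs_iff]] by simp
qed

lemma tendsto_padic_add:
  fixes X Y :: "nat \<Rightarrow> 'a"
  assumes "X \<longlonglongrightarrow> L" "Y \<longlonglongrightarrow> M"
  shows "(\<lambda>n. X n + Y n) \<longlonglongrightarrow> L + M"
proof (rule tendsto_pabsI)
  show "padic_abs (X n + Y n - (L + M)) \<le> padic_abs (X n - L) + padic_abs (Y n - M)" for n
    using pabs_add[of "X n - L" "Y n - M"] zero_le_dist[of "X n - L" 0]
      zero_le_dist[of "Y n - M" 0] unfolding add_diff_add by linarith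
  show "(\<lambda>n. padic_abs (X n - L) + padic_abs (Y n - M)) \<longlonglongrightarrow> 0"
    using tendsto_add[OF assms[unfolded tendsto_pabs_iff]] by simp
qed

lemma tendsto_padic_mult_left:
  fixes X :: "nat \<Rightarrow> 'a"
  assumes "X \<longlonglongrightarrow> L"
  shows "(\<lambda>n. c * X n) \<longlonglongrightarrow> c * L"
proof (rule tendsto_pabsI)
  show "padic_abs (c * X n - c * L) \<le> padic_abs c * padic_abs (X n - L)" for n
    by (simp add: pabs_mult flip: right_diff_distrib)
  show "(\<lambda>n. padic_abs c * padic_abs (X n - L)) \<longlonglongrightarrow> 0"
    using tendsto_mult_left[OF assms[unfolded tendsto_pabs_iff]] by simp
qed

lemma tendsto_padic_mult:
  fixes X Y :: "nat \<Rightarrow> 'a"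
  assumes "X \<longlonglongrightarrow> L" "Y \<longlonglongrightarrow> M" "\<And>n. padic_abs (X n) \<le> C"
  shows "(\<lambda>n. X n * Y n) \<longlonglongrightarrow> L * M"
proof (rule tendsto_padic_perturb)
  show "(\<lambda>n. X n * M) \<longlonglongrightarrow> L * M"
    using tendsto_padic_mult_left[OF assms(1), of M] by (simp add: mult.commute)
  show "padic_abs (X n * Y n - X n * M) \<le> C * padic_abs (Y n - M)" for n
    using mult_right_mono[OF assms(3), of "padic_abs (Y n - M)"]
    by (simp add: pabs_mult flip: right_diff_distrib)
  show "(\<lambda>n. C * padic_abs (Y n - M)) \<longlonglongrightarrow> 0"
    using tendsto_mult_left[OF assms(2)[unfolded tendsto_pabs_iff]] by simp
qed

lemma tendsto_padic_sum:
  fixes X :: "'b \<Rightarrow> nat \<Rightarrow> 'a"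
  assumes "\<And>i. i \<in> A \<Longrightarrow> X i \<longlonglongrightarrow> L i"
  shows "(\<lambda>n. \<Sum>i\<in>A. X i n) \<longlonglongrightarrow> (\<Sum>i\<in>A. L i)"
  using assms by (induction A rule: infinite_finite_induct) (auto intro: tendsto_padic_add)

lemma tendsto_pabs_le:
  fixes X :: "nat \<Rightarrow> 'a"
  assumes "X \<longlonglongrightarrow> L" "\<And>n. padic_abs (X n) \<le> B"
  shows "padic_abs L \<le> B"
  using tendsto_dist[OF assms(1) tendsto_const[of 0]] assms(2)
  by (intro LIMSEQ_le_const2) auto

text \<open>In an ultrametric space, consecutive differences that tend to 0 already make a sequence
  Cauchy. Monotonicity of \<open>B\<close> lets \<open>B m\<close> bound every difference from index
  \<open>m\<close> on.\<close>

lemma convergent_padicI: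
  fixes X :: "nat \<Rightarrow> 'a"
  assumes "\<And>n. padic_abs (X (Suc n) - X n) \<le> B n" "decseq B" "B \<longlonglongrightarrow> 0"
  shows "convergent X"
proof -
  have step: "padic_abs (X (m + k) - X m) \<le> B m" for m k
  proof (induction k)
    case 0
    show ?case
      using order_trans[OF zero_le_dist assms(1)[of m]] by simp
  next
    case (Suc k)
    have "padic_abs (X (Suc (m + k)) - X (m + k)) \<le> B m"
      using assms(1)[of "m + k"] decseqD[OF assms(2), of m "m + k"] by simp
    from pabs_diff_trans[OF this Suc] show ?case
      by simp
  qed
  have "Cauchy X"
  proof (rule metric_CauchyI)
    fix e :: real assume "e > 0"
    then have "eventually (\<lambda>n. B n < e) sequentially"
      by (rule order_tendstoD(2)[OF assms(3)])
    then obtain M where M: "\<And>n. n \<ge> M \<Longrightarrow> B n < e"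
      by (auto simp: eventually_sequentially)
    have "dist (X m) (X n) < e" if "m \<ge> M" "n \<ge> M" for m n
    proof -
      have "padic_abs (X m - X M) \<le> B M" "padic_abs (X M - X n) \<le> B M"
        using step[of M "m - M"] step[of M "n - M"] that by (auto simp: pabs_minus_commute)
      then have "padic_abs (X m - X n) \<le> B M"
        by (rule pabs_diff_trans)
      then show ?thesis
        using M[of M] by (simp add: dist_pabs[of "X m"])
    qed
    then show "\<exists>M. \<forall>m\<ge>M. \<forall>n\<ge>M. dist (X m) (X n) < e"
      by blast
  qed
  then show ?thesis
    by (rule Cauchy_convergent)
qed

lemma inverse_p_power_LIMSEQ: "(\<lambda>n. C / real p ^ n) \<longlonglongrightarrow> 0"
  using tendsto_mult_left[OF LIMSEQ_power_zero[of "1 / real p"], of C] p_gt_1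
  by (simp add: power_one_over)

lemma decseq_inverse_p_power:
  assumes "C \<ge> 0"
  shows "decseq (\<lambda>n. C / real p ^ n)"
  unfolding decseq_def using p_gt_1 assms
  by (intro allI impI divide_left_mono power_increasing mult_pos_pos zero_less_power) auto

subsection \<open>Teichmueller representatives\<close>

text \<open>The cofactor of \<open>x - y\<close> is a sum of monomials of degree \<open>n\<close>,
  each of size at most \<open>r ^ n\<close>.\<close>

lemma pabs_power_diff:
  fixes x y :: 'a
  assumes "padic_abs x \<le> r" "padic_abs y \<le> r"
  shows "padic_abs (x ^ Suc n - y ^ Suc n) \<le> padic_abs (x - y) * r ^ n"
proof -
  have r: "r \<ge> 0"
    using assms(1) by (rule order_trans[OF zero_le_dist])
  have "padic_abs (x ^ i * y ^ (n - i)) \<le> r ^ n" if "i < Suc n" for i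
  proof -
    have "padic_abs (x ^ i * y ^ (n - i)) \<le> r ^ i * r ^ (n - i)"
      unfolding pabs_mult pabs_power using assms r by (intro mult_mono power_mono) auto
    then show ?thesis
      using that by (simp flip: power_add)
  qed
  then have "padic_abs (\<Sum>i<Suc n. x ^ i * y ^ (n - i)) \<le> r ^ n"
    using r by (intro pabs_sum) auto
  then show ?thesis
    unfolding diff_power_eq_sum pabs_mult by (intro mult_left_mono) auto
qed

text \<open>Modulo \<open>x - y\<close>, the cofactor of \<open>x - y\<close> in \<open>x\<^sup>p - y\<^sup>p\<close> is \<open>p y\<^sup>p\<^sup>-\<^sup>1\<close>.\<close>
lemma pabs_power_p_diff:
  fixes x y :: 'a
  assumes "padic_abs x \<le> 1" "padic_abs y \<le> 1" "padic_abs (x - y) \<le> 1 / real p"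
  shows "padic_abs (x ^ p - y ^ p) \<le> padic_abs (x - y) / real p"
proof -
  obtain m where m: "p = Suc m"
    using prime_gt_0_nat[OF prime_p] by (cases p) auto
  define S where "S = (\<Sum>i<Suc m. x ^ i * y ^ (m - i))"
  have "padic_abs (x ^ i * y ^ (m - i) - y ^ m) \<le> 1 / real p" if "i < Suc m" for i
  proof (cases i)
    case (Suc j)
    have "y ^ m = y ^ Suc j * y ^ (m - i)"
      unfolding power_add[symmetric] using that Suc by simp
    then have "x ^ i * y ^ (m - i) - y ^ m = (x ^ Suc j - y ^ Suc j) * y ^ (m - i)"
      by (simp only: Suc left_diff_distrib)
    then have "padic_abs (x ^ i * y ^ (m - i) - y ^ m)
        = padic_abs (x ^ Suc j - y ^ Suc j) * padic_abs y ^ (m - i)"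
      by (simp only: pabs_mult pabs_power)
    also have "\<dots> \<le> padic_abs (x - y) * 1"
      using pabs_power_diff[OF assms(1,2), of j] assms(2) by (intro mult_mono power_le_one) auto
    finally show ?thesis
      using assms(3) by simp
  qed (use p_gt_1 in auto)
  then have "padic_abs (\<Sum>i<Suc m. x ^ i * y ^ (m - i) - y ^ m) \<le> 1 / real p"
    by (intro pabs_sum) auto
  moreover have "(\<Sum>i<Suc m. x ^ i * y ^ (m - i) - y ^ m) = S - of_nat p * y ^ m"
    by (simp only: sum_subtractf S_def) (simp add: m)
  moreover have "padic_abs (of_nat p * y ^ m) \<le> 1 / real p"
    using assms(2) by (simp add: pabs_mult pabs_power pabs_p power_le_one divide_right_mono)
  ultimately have S: "padic_abs S \<le> 1 / real p"
    using pabs_add[of "S - of_nat p * y ^ m" "of_nat p * y ^ m"] by simp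
  have "padic_abs (x ^ p - y ^ p) = padic_abs (x - y) * padic_abs S"
    unfolding m diff_power_eq_sum pabs_mult S_def ..
  also have "\<dots> \<le> padic_abs (x - y) * (1 / real p)"
    using S by (intro mult_left_mono) auto
  finally show ?thesis
    by simp
qed

text \<open>Fermat's little theorem for a natural number \<open>m\<close> in the residue class of
  \<open>y\<close>, carried over to \<open>y\<close> because congruent elements have congruent
  \<open>p\<close>-th powers.\<close>

lemma pabs_fermat:
  assumes "(y::'a) \<in> padic_ints"
  shows "padic_abs (y ^ p - y) \<le> 1 / real p"
proof -
  obtain n where n: "padic_abs (y - of_int n) \<le> 1 / real p ^ 1"
    using assms by (rule padic_ints_approx)
  define m where "m = nat (n mod int p)"
  have "int p dvd n - int m"
    using p_gt_1 by (simp add: m_def minus_mod_eq_mult_div)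
  then have "padic_abs (of_int (n - int m) :: 'a) \<le> 1 / real p ^ 1"
    by (subst pabs_of_int_le_iff) simp
  then have ym: "padic_abs (y - of_nat m) \<le> 1 / real p"
    using pabs_diff_trans[of y "of_int n" "1 / real p" "of_nat m"] n by simp
  have "int p dvd int m ^ p - int m"
  proof (cases "p dvd m")
    case True
    then have "int p dvd int m"
      by simp
    then show ?thesis
      using prime_gt_0_nat[OF prime_p] by (intro dvd_diff dvd_trans[OF _ dvd_power]) auto
  next
    case False
    have "[m ^ (p - 1) * m = 1 * m] (mod p)"
      using fermat_theorem[OF prime_p False] by (rule cong_scalar_right)
    then have "[m ^ p = m] (mod p)"
      using prime_gt_0_nat[OF prime_p] by (simp flip: power_Suc2)
    then have "[int m ^ p = int m] (mod int p)"
      using cong_int_iff[of "m ^ p" m p] by simp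
    then show ?thesis
      by (simp add: cong_iff_dvd_diff)
  qed
  then have "padic_abs (of_int (int m ^ p - int m) :: 'a) \<le> 1 / real p ^ 1"
    by (subst pabs_of_int_le_iff) simp
  then have m: "padic_abs (of_nat m ^ p - of_nat m :: 'a) \<le> 1 / real p"
    by simp
  have "padic_abs (y ^ p - of_nat m ^ p) \<le> padic_abs (y - of_nat m) / real p"
    by (rule pabs_power_p_diff) (use assms ym in \<open>auto simp: pabs_padic_ints pabs_of_nat\<close>)
  also have "\<dots> \<le> 1 / real p"
    using order_trans[OF ym, of 1] p_gt_1 by (simp add: divide_right_mono)
  finally have "padic_abs (y ^ p - of_nat m) \<le> 1 / real p"
    using m by (rule pabs_diff_trans)
  then show ?thesis
    by (rule pabs_diff_trans) (use ym in \<open>simp add: pabs_minus_commute\<close>)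
qed

definition padic_units :: "'a set"
  where "padic_units = {y \<in> padic_ints. padic_abs y = 1}"

lemma padic_units_mult: "y \<in> padic_units \<Longrightarrow> z \<in> padic_units \<Longrightarrow> y * z \<in> padic_units"
  by (auto simp: padic_units_def padic_ints_mult pabs_mult)

lemma padic_units_uminus: "y \<in> padic_units \<Longrightarrow> - y \<in> padic_units"
  by (auto simp: padic_units_def padic_ints_uminus)

lemma padic_cong_p_pabs:
  assumes "padic_cong w (y::'a) p"
  shows "padic_abs (w - y) \<le> 1 / real p"
proof -
  obtain z where z: "z \<in> padic_ints" "w - y = of_nat p * z"
    using assms unfolding padic_cong_def by blast
  then show ?thesis
    using pabs_padic_ints[OF z(1)] by (simp add: pabs_mult pabs_p divide_right_mono)
qed

lemma pabs_root_of_unity: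
  assumes "(w::'a) ^ n = 1" "n > 0"
  shows "padic_abs w = 1"
proof -
  have "padic_abs w ^ n = 1"
    using assms by (simp flip: pabs_power)
  then show ?thesis
    using assms(2) power_eq_imp_eq_base[of "padic_abs w" n 1] by simp
qed

text \<open>Both roots are fixed by \<open>p\<close>-th powering, which shrinks the distance of
  congruent elements by the factor \<open>1 / p\<close>; a positive distance is impossible.\<close>

lemma teichmueller_unique:
  fixes w w' :: 'a
  assumes "w ^ (p - 1) = 1" "w' ^ (p - 1) = 1" "padic_abs (w - w') \<le> 1 / real p"
  shows "w = w'"
proof (rule ccontr)
  assume "w \<noteq> w'"
  then have pos: "padic_abs (w - w') > 0"
    by simp
  obtain m where m: "p = Suc m" "m > 0"
    using prime_gt_1_nat[OF prime_p] by (cases p) auto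
  have "w ^ p = w" "w' ^ p = w'"
    using assms(1,2) by (simp_all add: m)
  moreover have "padic_abs w = 1" "padic_abs w' = 1"
    using assms(1,2) m by (auto intro!: pabs_root_of_unity[of _ m])
  ultimately have "padic_abs (w - w') \<le> padic_abs (w - w') / real p"
    using pabs_power_p_diff[of w w'] assms(3) by simp
  then show False
    using pos p_gt_1 by (simp add: field_simps)
qed

text \<open>The Teichmueller representative is the limit of \<open>y\<^sup>q\<close> over the powers \<open>q\<close> of \<open>p\<close>.\<close>
lemma teichmueller_exists:
  assumes "y \<in> padic_units"
  shows "\<exists>w. w ^ (p - 1) = 1 \<and> padic_cong w y p"
proof -
  have y: "y \<in> padic_ints" "padic_abs y = 1"
    using assms by (auto simp: padic_units_def)
  define X where "X = (\<lambda>n. y ^ (p ^ n))"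
  have X_ints: "X n \<in> padic_ints" for n
    unfolding X_def using y(1) by (rule padic_ints_power)
  have X_abs: "padic_abs (X n) = 1" for n
    by (simp add: X_def pabs_power y)
  have X_Suc: "X (Suc n) = X n ^ p" for n
    by (simp add: X_def power_mult[symmetric] mult.commute)
  \<comment> \<open>Fermat starts the induction; every further \<open>p\<close>-th power gains a
    factor \<open>1 / p\<close>.\<close>
  have step: "padic_abs (X (Suc n) - X n) \<le> (1 / real p) / real p ^ n" for n
  proof (induction n)
    case 0
    show ?case
      using pabs_fermat[OF y(1)] by (simp add: X_def)
  next
    case (Suc n)
    have "(1 / real p) / real p ^ n \<le> 1 / real p"
      using p_gt_1 by (simp add: field_simps)
    then have "padic_abs (X (Suc n) - X n) \<le> 1 / real p"
      using Suc by linarith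
    then have "padic_abs (X (Suc n) ^ p - X n ^ p) \<le> padic_abs (X (Suc n) - X n) / real p"
      by (rule pabs_power_p_diff[rotated 2]) (simp_all add: X_abs)
    also have "\<dots> \<le> (1 / real p) / real p ^ n / real p"
      using Suc by (rule divide_right_mono) simp
    finally show ?case
      unfolding X_Suc[symmetric] by (simp add: mult_ac)
  qed
  have "convergent X"
    by (rule convergent_padicI[OF step decseq_inverse_p_power inverse_p_power_LIMSEQ]) simp
  then obtain w where w: "X \<longlonglongrightarrow> w"
    unfolding convergent_def by blast
  have w_ints: "w \<in> padic_ints"
    using X_ints w unfolding padic_ints_def
    by (rule closed_sequentially[OF closed_closure])
  have pow: "(\<lambda>n. X n ^ k) \<longlonglongrightarrow> w ^ k" for k
  proof (induction k)
    case (Suc k)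
    show ?case
      using tendsto_padic_mult[OF w Suc, of 1] by (simp add: X_abs)
  qed auto
  have "(\<lambda>n. X n ^ p) \<longlonglongrightarrow> w"
    using LIMSEQ_Suc[OF w] unfolding X_Suc .
  then have "w ^ p = w"
    using pow[of p] LIMSEQ_unique by blast
  moreover have "w ^ p = w * w ^ (p - 1)"
    using prime_gt_0_nat[OF prime_p] by (simp flip: power_Suc)
  ultimately have "w * w ^ (p - 1) = w * 1"
    by simp
  \<comment> \<open>The absolute value 1 of all \<open>X n\<close> passes to the limit, so
    \<open>w\<close> can be cancelled in \<open>w ^ p = w\<close>.\<close>
  moreover have "w \<noteq> 0"
  proof
    assume "w = 0"
    then show False
      using tendsto_dist[OF w tendsto_const[of 0]] by (simp add: X_abs tendsto_const_iff)
  qed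
  ultimately have "w ^ (p - 1) = 1"
    by (metis mult_left_cancel)
  moreover have "padic_cong w y p"
  proof -
    \<comment> \<open>All \<open>X n\<close> stay in the residue class of \<open>y\<close>, which is
      closed and hence contains the limit.\<close>
    have "padic_abs (X n - y) \<le> 1 / real p" for n
    proof (induction n)
      case 0
      then show ?case
        by (simp add: X_def)
    next
      case (Suc n)
      have "(1 / real p) / real p ^ n \<le> 1 / real p"
        using p_gt_1 by (simp add: field_simps)
      then show ?case
        using pabs_diff_trans[OF order_trans[OF step[of n]] Suc] by blast
    qed
    moreover have "(\<lambda>n. X n - y) \<longlonglongrightarrow> w - y"
      using tendsto_padic_add[OF w tendsto_const[of "- y"]] by simp
    ultimately have "padic_abs (w - y) \<le> 1 / real p"
      by (rule tendsto_pabs_le[rotated])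
    then show ?thesis
      using padic_cong_iff_pabs[OF w_ints y(1), of 1] by simp
  qed
  ultimately show ?thesis
    by blast
qed

lemma teichmueller_eqI:
  assumes "y \<in> padic_units" "w ^ (p - 1) = 1" "padic_cong w y p"
  shows "teichmueller p y = w"
  unfolding teichmueller_def
proof (rule the_equality)
  fix w' assume w': "w' ^ (p - 1) = 1 \<and> padic_cong w' y p"
  then have "padic_abs (w' - y) \<le> 1 / real p"
    using padic_cong_p_pabs by blast
  moreover have "padic_abs (y - w) \<le> 1 / real p"
    using padic_cong_p_pabs[OF assms(3)] by (simp add: pabs_minus_commute)
  ultimately have "padic_abs (w' - w) \<le> 1 / real p"
    by (rule pabs_diff_trans)
  then show "w' = w"
    using teichmueller_unique w' assms(2) by blast
qed (use assms in blast)

lemma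
  assumes "y \<in> padic_units"
  shows teichmueller_power: "teichmueller p y ^ (p - 1) = 1"
    and teichmueller_cong: "padic_cong (teichmueller p y) y p"
proof -
  obtain w where w: "w ^ (p - 1) = 1" "padic_cong w y p"
    using teichmueller_exists[OF assms] by blast
  then have "teichmueller p y = w"
    by (rule teichmueller_eqI[OF assms])
  then show "teichmueller p y ^ (p - 1) = 1" "padic_cong (teichmueller p y) y p"
    using w by simp_all
qed

lemma pabs_teichmueller:
  assumes "y \<in> padic_units"
  shows "padic_abs (teichmueller p y) = 1"
  using teichmueller_power[OF assms] prime_gt_1_nat[OF prime_p] by (intro pabs_root_of_unity) auto

lemma teichmueller_nonzero: "y \<in> padic_units \<Longrightarrow> teichmueller p y \<noteq> 0"
  using pabs_teichmueller[of y] by auto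

lemma padic_cong_mult:
  fixes w w' y y' :: 'a
  assumes "padic_cong w y p" "padic_cong w' y' p" "y \<in> padic_ints" "y' \<in> padic_ints"
  shows "padic_cong (w * w') (y * y') p"
proof -
  obtain z z' where z: "z \<in> padic_ints" "z' \<in> padic_ints"
      and "w - y = of_nat p * z" "w' - y' = of_nat p * z'"
    using assms(1,2) unfolding padic_cong_def by blast
  then have "w = y + of_nat p * z" "w' = y' + of_nat p * z'"
    by (simp_all add: algebra_simps)
  then have "w * w' - y * y' = of_nat p * (z * y' + y * z' + of_nat p * z * z')"
    by (simp add: algebra_simps)
  moreover have "z * y' + y * z' + of_nat p * z * z' \<in> padic_ints"
    using z assms(3,4) by (intro padic_ints_add padic_ints_mult) auto
  ultimately show ?thesis
    unfolding padic_cong_def by blast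
qed

lemma teichmueller_mult:
  assumes "y \<in> padic_units" "z \<in> padic_units"
  shows "teichmueller p (y * z) = teichmueller p y * teichmueller p z"
proof (rule teichmueller_eqI)
  show "(teichmueller p y * teichmueller p z) ^ (p - 1) = 1"
    unfolding power_mult_distrib by (simp only: assms teichmueller_power mult_1)
  show "padic_cong (teichmueller p y * teichmueller p z) (y * z) p"
    using assms by (intro padic_cong_mult teichmueller_cong) (auto simp: padic_units_def)
qed (use assms padic_units_mult in blast)

lemma teichmueller_cong_eq:
  assumes "y \<in> padic_units" "y' \<in> padic_units" "padic_abs (y - y') \<le> 1 / real p"
  shows "teichmueller p y = teichmueller p y'"
proof -
  have "padic_abs (teichmueller p y - y') \<le> 1 / real p"
    using padic_cong_p_pabs[OF teichmueller_cong[OF assms(1)]] assms(3) by (rule pabs_diff_trans)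
  moreover have "padic_abs (y' - teichmueller p y') \<le> 1 / real p"
    using padic_cong_p_pabs[OF teichmueller_cong[OF assms(2)]] by (simp add: pabs_minus_commute)
  ultimately have "padic_abs (teichmueller p y - teichmueller p y') \<le> 1 / real p"
    by (rule pabs_diff_trans)
  then show ?thesis
    using teichmueller_unique teichmueller_power assms by blast
qed

section \<open>The projection of a unit to the units congruent to 1\<close>

lemma pabs_angle_minus_1:
  assumes "y \<in> padic_units"
  shows "padic_abs (padic_angle p y - 1) \<le> 1 / real p"
proof -
  have "padic_angle p y - 1 = (y - teichmueller p y) / teichmueller p y"
    using teichmueller_nonzero[OF assms] by (simp add: padic_angle_def field_simps)
  then show ?thesis
    using padic_cong_p_pabs[OF teichmueller_cong[OF assms]]
    by (simp add: pabs_divide pabs_teichmueller assms pabs_minus_commute)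
qed

lemma padic_angle_mult:
  assumes "y \<in> padic_units" "z \<in> padic_units"
  shows "padic_angle p (y * z) = padic_angle p y * padic_angle p z"
  by (simp add: padic_angle_def teichmueller_mult assms)

text \<open>Units in one residue class share their Teichmueller representative, and dividing by an
  element of absolute value 1 preserves distances.\<close>

lemma pabs_angle_diff:
  assumes "y \<in> padic_units" "y' \<in> padic_units" "padic_abs (y - y') \<le> 1 / real p"
  shows "padic_abs (padic_angle p y - padic_angle p y') = padic_abs (y - y')"
  unfolding padic_angle_def teichmueller_cong_eq[OF assms]
  by (simp add: pabs_divide pabs_teichmueller assms flip: diff_divide_distrib)

text \<open>For odd \<open>p\<close> the exponent \<open>p - 1\<close> is even, so the negative of a
  \<open>(p - 1)\<close>-th root of unity is again one, and the two signs cancel in the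
  quotient.\<close>

lemma padic_angle_uminus:
  assumes "odd p" "y \<in> padic_units"
  shows "padic_angle p (- y) = padic_angle p y"
proof -
  have "teichmueller p (- y) = - teichmueller p y"
  proof (rule teichmueller_eqI)
    show "(- teichmueller p y) ^ (p - 1) = 1"
      using assms teichmueller_power by (simp add: power_minus_even)
    show "padic_cong (- teichmueller p y) (- y) p"
    proof -
      have "padic_cong (- 1) (- 1 :: 'a) p"
        unfolding padic_cong_def by (intro bexI[of _ 0]) auto
      then show ?thesis
        using padic_cong_mult[OF _ teichmueller_cong[OF assms(2)], of "-1" "-1"] assms(2)
        by (simp add: padic_units_def padic_ints_uminus)
    qed
  qed (use assms padic_units_uminus in auto)
  then show ?thesis
    by (simp add: padic_angle_def)
qed

end

section \<open>The binomial series\<close>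

lemma gbinomial_poly:
  obtains P :: "'b::field_char_0 poly" where "\<And>t. poly P t = t gchoose k"
proof
  show "poly (smult (inverse (fact k)) (\<Prod>i<k. [:- of_nat i, 1:])) t = t gchoose k" for t :: 'b
    by (simp add: gbinomial_prod_rev poly_prod atLeast0LessThan divide_inverse mult.commute)
qed

lemma poly_eq_of_nat:
  fixes P Q :: "'b::field_char_0 poly"
  assumes "\<And>m. poly P (of_nat m) = poly Q (of_nat m)"
  shows "P = Q"
proof (rule ccontr)
  assume "P \<noteq> Q"
  then have "finite {x. poly (P - Q) x = 0}"
    by (intro poly_roots_finite) simp
  moreover have "range of_nat \<subseteq> {x. poly (P - Q) x = 0}"
    using assms by auto
  ultimately have "finite (range (of_nat :: nat \<Rightarrow> 'b))"
    by (rule rev_finite_subset)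
  then show False
    using range_inj_infinite[OF inj_of_nat] by blast
qed

lemma coeff_one_plus_power:
  "coeff ([:1, u:] ^ m) i = (of_nat m gchoose i) * (u :: 'b::field_char_0) ^ i"
proof (cases "i \<le> m")
  case True
  then show ?thesis
    by (simp add: coeff_linear_poly_power flip: binomial_gbinomial)
next
  case False
  have "degree ([:1, u:] ^ m) \<le> degree [:1, u:] * m"
    by (rule degree_power_le)
  also have "\<dots> \<le> 1 * m"
    by (intro mult_right_mono) auto
  finally show ?thesis
    using False by (simp add: coeff_eq_0 binomial_eq_0 flip: binomial_gbinomial)
qed

text \<open>With \<open>A\<close> for the quadratic polynomial on the left, both sides are
  polynomials in \<open>t\<close>. At a natural number \<open>t\<close> they are the coefficient of
  degree \<open>n\<close> in \<open>(1 + A) ^ t\<close>, since \<open>1 + A\<close> factors as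
  \<open>(1 + u X) (1 + w X)\<close>. Agreement at all natural numbers suffices.\<close>

lemma gbinomial_mult_coeff:
  fixes t u w :: "'b::field_char_0"
  assumes "n < K"
  shows "(\<Sum>k<K. (t gchoose k) * coeff ([:0, u + w, u * w:] ^ k) n)
    = (\<Sum>i\<le>n. (t gchoose i) * u ^ i * ((t gchoose (n - i)) * w ^ (n - i)))"
proof -
  let ?A = "[:0, u + w, u * w:]"
  have "\<exists>P. \<forall>k t. poly (P k) t = (t :: 'b) gchoose k"
    using gbinomial_poly by metis
  then obtain P where P: "\<And>k t. poly (P k) t = (t :: 'b) gchoose k"
    by blast
  have "(\<Sum>k<K. smult (coeff (?A ^ k) n) (P k))
      = (\<Sum>i\<le>n. smult (u ^ i * w ^ (n - i)) (P i * P (n - i)))"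
  proof (rule poly_eq_of_nat)
    fix m
    \<comment> \<open>\<open>A\<close> is divisible by the variable, so \<open>A ^ k\<close> starts
      in degree \<open>k\<close>. Hence the cut-off \<open>K\<close> beyond \<open>n\<close> loses
      nothing.\<close>
    have coeff_0: "coeff (?A ^ k) n = 0" if "n < k" for k
    proof -
      have "?A = monom 1 1 * [:u + w, u * w:]"
        by (simp add: monom_altdef)
      then have "?A ^ k = monom 1 k * [:u + w, u * w:] ^ k"
        by (simp only: power_mult_distrib monom_power) simp
      then show ?thesis
        using that by (simp add: coeff_monom_mult)
    qed
    \<comment> \<open>The two ranges differ only in terms that vanish: through the coefficient for
      \<open>k\<close> beyond \<open>n\<close>, through the binomial for \<open>k\<close> beyond
      \<open>m\<close>.\<close>
    have "(\<Sum>k<K. (of_nat m gchoose k) * coeff (?A ^ k) n)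
        = (\<Sum>k\<le>m. (of_nat m gchoose k) * coeff (?A ^ k) n)"
      using assms by (intro sum.mono_neutral_cong)
        (auto simp: coeff_0 binomial_eq_0 simp flip: binomial_gbinomial)
    also have "\<dots> = coeff ((1 + ?A) ^ m) n"
      by (simp add: binomial_ring add.commute[of 1] coeff_sum of_nat_poly binomial_gbinomial)
    also have "1 + ?A = [:1, u:] * [:1, w:]"
      by (simp add: algebra_simps one_pCons)
    also have "coeff (\<dots> ^ m) n = (\<Sum>i\<le>n. (of_nat m gchoose i) * u ^ i * ((of_nat m gchoose (n - i)) * w ^ (n - i)))"
      unfolding power_mult_distrib coeff_mult coeff_one_plus_power ..
    finally show "poly (\<Sum>k<K. smult (coeff (?A ^ k) n) (P k)) (of_nat m)
        = poly (\<Sum>i\<le>n. smult (u ^ i * w ^ (n - i)) (P i * P (n - i))) (of_nat m)"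
      by (simp add: poly_sum P mult_ac)
  qed
  then have "poly (\<Sum>k<K. smult (coeff (?A ^ k) n) (P k)) t
      = poly (\<Sum>i\<le>n. smult (u ^ i * w ^ (n - i)) (P i * P (n - i))) t"
    by simp
  then show ?thesis
    by (simp add: poly_sum P mult_ac)
qed

section \<open>Sizes of factorials and of binomial coefficients\<close>

context padic_valued_field
begin

text \<open>By Legendre's formula, \<open>1 / |k!|\<close> grows like the \<open>k\<close>-th power of the following number.\<close>
definition fact_root :: real
  where "fact_root = real p powr (1 / (real p - 1))"

lemma fact_root_ge_1: "fact_root \<ge> 1"
  using p_gt_1 by (simp add: fact_root_def ge_one_powr_ge_zero)

text \<open>The identity that matches the recursion of \<open>|k!|\<close> under division of
  \<open>k\<close> by \<open>p\<close>.\<close>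

lemma fact_root_power: "fact_root ^ p = real p * fact_root"
proof -
  have "fact_root ^ (p - 1) = fact_root powr (real p - 1)"
    using fact_root_ge_1 prime_gt_0_nat[OF prime_p] by (simp add: powr_realpow[symmetric] of_nat_diff)
  also have "\<dots> = real p"
    using p_gt_1 by (simp add: fact_root_def powr_powr)
  finally show ?thesis
    using prime_gt_0_nat[OF prime_p] by (cases p) auto
qed

lemma pabs_fact_add:
  assumes "r < p"
  shows "padic_abs (fact (p * m + r) :: 'a) = padic_abs (fact (p * m) :: 'a)"
  using assms
proof (induction r)
  case (Suc r)
  have "\<not> p dvd Suc (p * m + r)"
    using Suc.prems by (metis add_Suc_right dvd_add_right_iff dvd_triv_left nat_dvd_not_less zero_less_Suc)
  then have "padic_abs (of_nat (Suc (p * m + r)) :: 'a) = 1"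
    by (rule pabs_of_nat_coprime)
  then show ?case
    using Suc by (simp add: pabs_mult del: of_nat_Suc)
qed auto

text \<open>Among the \<open>p\<close> factors that lead from \<open>(p m)!\<close> to
  \<open>(p (m + 1))!\<close> only the last, \<open>p (m + 1)\<close>, is divisible by
  \<open>p\<close>.\<close>

lemma pabs_fact_mult: "padic_abs (fact (p * m) :: 'a) = padic_abs (fact m :: 'a) / real p ^ m"
proof (induction m)
  case (Suc m)
  obtain r where r: "p = Suc r"
    using prime_gt_0_nat[OF prime_p] by (cases p) auto
  have "p * Suc m = Suc (p * m + r)"
    using r by simp
  then have "fact (p * Suc m) = (of_nat (p * Suc m) :: 'a) * fact (p * m + r)"
    by (metis fact_Suc)
  then have "padic_abs (fact (p * Suc m) :: 'a)
      = 1 / real p * padic_abs (of_nat (Suc m) :: 'a) * padic_abs (fact (p * m + r) :: 'a)"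
    by (simp only: of_nat_mult pabs_mult pabs_p)
  also have "padic_abs (fact (p * m + r) :: 'a) = padic_abs (fact m :: 'a) / real p ^ m"
    using Suc pabs_fact_add[of r m] r by simp
  finally show ?case
    by (simp add: pabs_mult mult_ac del: of_nat_Suc mult_Suc_right)
qed auto

text \<open>Strong induction along \<open>k = p m + r\<close>: passing from \<open>m\<close> to
  \<open>k\<close> divides the absolute value of the factorial by \<open>p ^ m\<close>, while
  \<open>fact_root ^ (p m)\<close> supplies exactly \<open>p ^ m\<close> times
  \<open>fact_root ^ m\<close>. For \<open>k < p\<close> the factorial is a unit.\<close>

lemma pabs_fact_ge: "padic_abs (fact k :: 'a) * fact_root ^ k \<ge> 1"
proof (induction k rule: less_induct)
  case (less k)
  define m r where "m = k div p" and "r = k mod p"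
  have k: "k = p * m + r" and r: "r < p"
    using prime_gt_0_nat[OF prime_p] by (simp_all add: m_def r_def)
  show ?case
  proof (cases "m = 0")
    case True
    then have "padic_abs (fact k :: 'a) = 1"
      using pabs_fact_add[OF r, of 0] k by simp
    then show ?thesis
      using fact_root_ge_1 by simp
  next
    case False
    then have "m < k"
      using prime_gt_1_nat[OF prime_p] by (cases "k = 0") (auto simp: m_def)
    have "1 \<le> padic_abs (fact m :: 'a) * fact_root ^ m"
      using less \<open>m < k\<close> by blast
    also have "\<dots> = padic_abs (fact k :: 'a) * fact_root ^ (p * m)"
      using p_gt_1 by (simp add: k pabs_fact_add[OF r] pabs_fact_mult power_mult fact_root_power
          power_mult_distrib)
    also have "\<dots> \<le> padic_abs (fact k :: 'a) * fact_root ^ k"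
      using fact_root_ge_1 by (intro mult_left_mono power_increasing) (auto simp: k)
    finally show ?thesis .
  qed
qed

text \<open>Since \<open>M\<close> is at least 1, subtracting integers from \<open>t\<close> does
  not leave the ball of radius \<open>M\<close>, which bounds the numerator by \<open>M ^ k\<close>;
  \<open>pabs_fact_ge\<close> bounds the denominator.\<close>

lemma pabs_gbinomial:
  fixes t :: 'a
  assumes "padic_abs t \<le> M" "M \<ge> 1"
  shows "padic_abs (t gchoose k) \<le> (M * fact_root) ^ k"
proof -
  have "padic_abs (t - of_nat i) \<le> M" for i
    using pabs_diff[of t "of_nat i"] pabs_of_nat[of i] assms by simp
  then have "(\<Prod>i = 0..<k. padic_abs (t - of_nat i)) \<le> (\<Prod>i = 0..<k. M)"
    by (intro prod_mono) auto
  then have num: "(\<Prod>i = 0..<k. padic_abs (t - of_nat i)) \<le> M ^ k"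
    by simp
  have "padic_abs (t gchoose k) = (\<Prod>i = 0..<k. padic_abs (t - of_nat i)) / padic_abs (fact k :: 'a)"
    by (simp add: gbinomial_prod_rev pabs_divide pabs_prod)
  also have "\<dots> \<le> M ^ k / padic_abs (fact k :: 'a)"
    using num by (intro divide_right_mono) auto
  also have "\<dots> \<le> M ^ k * fact_root ^ k"
  proof -
    have "M ^ k * 1 \<le> M ^ k * (padic_abs (fact k :: 'a) * fact_root ^ k)"
      using pabs_fact_ge[of k] assms(2) by (intro mult_left_mono) auto
    then show ?thesis
      by (simp add: field_simps)
  qed
  finally show ?thesis
    by (simp add: power_mult_distrib)
qed

section \<open>Series with geometric bounds, their products, and bounds on polynomial
  coefficients\<close>

lemma sums_pabs:
  fixes f :: "nat \<Rightarrow> 'a"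
  assumes "\<And>k. padic_abs (f k) \<le> \<rho> ^ k" "0 \<le> \<rho>" "\<rho> < 1"
  shows "f sums suminf f"
proof -
  have "convergent (\<lambda>n. sum f {..<n})"
  proof (rule convergent_padicI)
    show "padic_abs (sum f {..<Suc n} - sum f {..<n}) \<le> \<rho> ^ n" for n
      using assms(1) by simp
    show "decseq (\<lambda>n. \<rho> ^ n)"
      using assms(2,3) by (auto simp: decseq_def intro: power_decreasing)
    show "(\<lambda>n. \<rho> ^ n) \<longlonglongrightarrow> 0"
      using assms(2,3) by (intro LIMSEQ_power_zero) auto
  qed
  then have "summable f"
    by (auto simp: summable_def sums_def convergent_def)
  then show ?thesis
    unfolding summable_def suminf_def by (metis sums_unique suminf_def)
qed

text \<open>The product of two partial sums runs over a square, the Cauchy product over the triangle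
  \<open>i + j < n\<close>. Each pair in the difference has \<open>i + j \<ge> n\<close>, so the
  ultrametric inequality bounds the whole difference by \<open>\<rho> ^ n\<close>.\<close>

lemma sums_mult_pabs:
  fixes f g :: "nat \<Rightarrow> 'a"
  assumes "\<And>k. padic_abs (f k) \<le> \<rho> ^ k" "\<And>k. padic_abs (g k) \<le> \<rho> ^ k" "0 \<le> \<rho>" "\<rho> < 1"
  shows "(\<lambda>n. \<Sum>i\<le>n. f i * g (n - i)) sums (suminf f * suminf g)"
  unfolding sums_def
proof (rule tendsto_padic_perturb)
  have "padic_abs (sum f {..<n}) \<le> 1" for n
    using assms power_le_one[of \<rho>] by (intro pabs_sum) (auto intro: order_trans)
  then show "(\<lambda>n. sum f {..<n} * sum g {..<n}) \<longlonglongrightarrow> suminf f * suminf g"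
    using sums_pabs assms unfolding sums_def by (intro tendsto_padic_mult) auto
  show "(\<lambda>n. \<rho> ^ n) \<longlonglongrightarrow> 0"
    using assms(3,4) by (intro LIMSEQ_power_zero) auto
  show "padic_abs ((\<Sum>k<n. \<Sum>i\<le>k. f i * g (k - i)) - sum f {..<n} * sum g {..<n}) \<le> \<rho> ^ n" for n
  proof -
    let ?T = "{(i, j). i + j < n}" and ?S = "{..<n} \<times> {..<n}"
    have fin: "finite ?S" and sub: "?T \<subseteq> ?S"
      by auto
    have "(\<Sum>(i,j)\<in>?S - ?T. f i * g j) + (\<Sum>(i,j)\<in>?T. f i * g j) = (\<Sum>(i,j)\<in>?S. f i * g j)"
      by (rule sum.subset_diff[OF sub fin, symmetric])
    moreover have "(\<Sum>(i,j)\<in>?S. f i * g j) = sum f {..<n} * sum g {..<n}"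
      by (simp add: sum_product sum.cartesian_product)
    moreover have "(\<Sum>(i,j)\<in>?T. f i * g j) = (\<Sum>k<n. \<Sum>i\<le>k. f i * g (k - i))"
      by (rule sum.triangle_reindex)
    ultimately have "sum f {..<n} * sum g {..<n} - (\<Sum>k<n. \<Sum>i\<le>k. f i * g (k - i))
        = (\<Sum>(i,j)\<in>?S - ?T. f i * g j)"
      by (simp add: algebra_simps)
    moreover have "padic_abs (\<Sum>(i,j)\<in>?S - ?T. f i * g j) \<le> \<rho> ^ n"
    proof (rule pabs_sum)
      fix ij assume "ij \<in> ?S - ?T"
      then obtain i j where ij: "ij = (i, j)" and "\<not> i + j < n"
        by auto
      have "padic_abs (f i * g j) \<le> \<rho> ^ i * \<rho> ^ j"
        unfolding pabs_mult using assms by (intro mult_mono) auto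
      also have "\<dots> \<le> \<rho> ^ n"
        using \<open>\<not> i + j < n\<close> assms by (simp flip: power_add) (intro power_decreasing, auto)
      finally show "padic_abs (case ij of (i, j) \<Rightarrow> f i * g j) \<le> \<rho> ^ n"
        by (simp add: ij)
    qed (use assms in auto)
    ultimately show ?thesis
      by (simp add: pabs_minus_commute)
  qed
qed

text \<open>For positive \<open>r\<close> the hypotheses place \<open>P\<close> and \<open>Q\<close>
  in the unit ball of a weighted Gauss norm, which is closed under products.\<close>

lemma pabs_coeff_mult:
  fixes P Q :: "'a poly"
  assumes "\<And>n. padic_abs (coeff P n) \<le> r ^ n" "\<And>n. padic_abs (coeff Q n) \<le> r ^ n" "r \<ge> 0"
  shows "padic_abs (coeff (P * Q) n) \<le> r ^ n"
  unfolding coeff_mult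
proof (rule pabs_sum)
  fix i assume "i \<in> {..n}"
  have "padic_abs (coeff P i * coeff Q (n - i)) \<le> r ^ i * r ^ (n - i)"
    unfolding pabs_mult using assms by (intro mult_mono) auto
  also have "\<dots> = r ^ n"
    using \<open>i \<in> {..n}\<close> by (simp flip: power_add)
  finally show "padic_abs (coeff P i * coeff Q (n - i)) \<le> r ^ n" .
qed (use assms in auto)

lemma pabs_coeff_power:
  fixes P :: "'a poly"
  assumes "\<And>n. padic_abs (coeff P n) \<le> r ^ n" "r \<ge> 0"
  shows "padic_abs (coeff (P ^ k) n) \<le> r ^ n"
proof (induction k arbitrary: n)
  case 0
  then show ?case
    using assms(2) by (simp add: coeff_1)
next
  case (Suc k)
  then show ?case
    unfolding power_Suc using assms by (intro pabs_coeff_mult)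
qed

definition binomial_series :: "'a \<Rightarrow> 'a \<Rightarrow> 'a"
  where "binomial_series t u = (\<Sum>k. (t gchoose k) * u ^ k)"

lemma angle_power_eq: "angle_power p y t = binomial_series t (padic_angle p y - 1)"
  by (simp add: angle_power_def binomial_series_def)

text \<open>Explains the radius: \<open>padic_radius p\<close> times \<open>fact_root\<close> is
  exactly \<open>p\<close>, the reciprocal of the bound on
  \<open>padic_angle p y - 1\<close>.\<close>

lemma exponent_bound:
  assumes "M < padic_radius p" "M \<ge> 0"
  shows "M * fact_root / real p < 1"
proof -
  have p: "real p > 0"
    using p_gt_1 by simp
  have "padic_radius p * fact_root = real p powr ((real p - 2) / (real p - 1) + 1 / (real p - 1))"
    by (simp add: padic_radius_def fact_root_def powr_add)
  also have "(real p - 2) / (real p - 1) + 1 / (real p - 1) = 1"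
    using p_gt_1 by (simp add: field_simps)
  finally have "padic_radius p * fact_root = real p"
    using p by simp
  moreover have "M * fact_root < padic_radius p * fact_root"
    using assms fact_root_ge_1 by (intro mult_strict_right_mono) auto
  ultimately show ?thesis
    using p by simp
qed

end

section \<open>Functional equations of the binomial series for exponents of size at most
  \<open>M\<close>\<close>

locale padic_exponent = padic_valued_field p ty
  for p :: nat and ty :: "'a::{field_char_0,complete_space} itself" +
  fixes M :: real
  assumes M_ge_1: "M \<ge> 1" and M_less: "M < padic_radius p"
begin

text \<open>The ratio of the geometric majorant: \<open>M * fact_root\<close> comes from the
  binomial coefficient, \<open>1 / p\<close> from the base point.\<close>

definition rate :: real where "rate = M * fact_root / real p"

lemma rate_less_1: "rate < 1"
  unfolding rate_def using M_ge_1 M_less by (intro exponent_bound) auto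

lemma rate_nonneg: "rate \<ge> 0"
  using M_ge_1 fact_root_ge_1 by (simp add: rate_def)

lemma M_fact_root_ge_1: "M * fact_root \<ge> 1"
  using mult_mono[OF M_ge_1 fact_root_ge_1] M_ge_1 by simp

lemma binomial_series_term:
  fixes s t u w :: 'a
  assumes "padic_abs t \<le> M" "padic_abs u \<le> 1 / real p"
  shows "padic_abs ((t gchoose k) * u ^ k) \<le> rate ^ k"
proof -
  have "padic_abs ((t gchoose k) * u ^ k) \<le> (M * fact_root) ^ k * (1 / real p) ^ k"
    unfolding pabs_mult pabs_power using assms pabs_gbinomial[OF assms(1) M_ge_1] M_fact_root_ge_1
    by (intro mult_mono power_mono) auto
  then show ?thesis
    by (simp add: rate_def power_divide power_one_over)
qed

lemma binomial_series_sums: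
  fixes s t u w :: 'a
  assumes "padic_abs t \<le> M" "padic_abs u \<le> 1 / real p"
  shows "(\<lambda>k. (t gchoose k) * u ^ k) sums binomial_series t u"
  unfolding binomial_series_def
  using binomial_series_term[OF assms] rate_nonneg rate_less_1 by (rule sums_pabs)

lemma pabs_binomial_series:
  fixes s t u w :: 'a
  assumes "padic_abs t \<le> M" "padic_abs u \<le> 1 / real p"
  shows "padic_abs (binomial_series t u) \<le> 1"
proof (rule tendsto_pabs_le)
  show "(\<lambda>n. \<Sum>k<n. (t gchoose k) * u ^ k) \<longlonglongrightarrow> binomial_series t u"
    using binomial_series_sums[OF assms] by (simp add: sums_def)
  show "padic_abs (\<Sum>k<n. (t gchoose k) * u ^ k) \<le> 1" for n
    using binomial_series_term[OF assms] rate_nonneg rate_less_1 power_le_one[of rate]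
    by (intro pabs_sum) (auto intro: order_trans)
qed

text \<open>Termwise, \<open>u ^ k - w ^ k\<close> contributes \<open>|u - w|\<close> and only
  \<open>k - 1\<close> further factors \<open>1 / p\<close>. The one missing factor is the Lipschitz
  constant \<open>p\<close>.\<close>

lemma pabs_binomial_series_diff:
  fixes s t u w :: 'a
  assumes "padic_abs t \<le> M" "padic_abs u \<le> 1 / real p" "padic_abs w \<le> 1 / real p"
  shows "padic_abs (binomial_series t u - binomial_series t w) \<le> real p * padic_abs (u - w)"
proof (rule tendsto_pabs_le)
  show "(\<lambda>n. (\<Sum>k<n. (t gchoose k) * u ^ k) + (- 1) * (\<Sum>k<n. (t gchoose k) * w ^ k))
      \<longlonglongrightarrow> binomial_series t u - binomial_series t w"
    using tendsto_padic_add[OF binomial_series_sums[OF assms(1,2), unfolded sums_def]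
      tendsto_padic_mult_left[OF binomial_series_sums[OF assms(1,3), unfolded sums_def], of "- 1"]]
    by simp
  have "padic_abs ((t gchoose k) * (u ^ k - w ^ k)) \<le> real p * padic_abs (u - w)" for k
  proof (cases k)
    case (Suc j)
    have "padic_abs ((t gchoose k) * (u ^ k - w ^ k))
        \<le> (M * fact_root) ^ k * (padic_abs (u - w) * (1 / real p) ^ j)"
      unfolding pabs_mult Suc
      using pabs_gbinomial[OF assms(1) M_ge_1] pabs_power_diff[OF assms(2,3)] M_fact_root_ge_1
      by (intro mult_mono) (auto simp del: power_Suc)
    also have "\<dots> = rate ^ k * (real p * padic_abs (u - w))"
      using p_gt_1 by (simp add: rate_def Suc power_divide power_one_over)
    also have "\<dots> \<le> 1 * (real p * padic_abs (u - w))"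
      using rate_nonneg rate_less_1 by (intro mult_right_mono power_le_one) auto
    finally show ?thesis
      by simp
  qed auto
  then have "padic_abs (\<Sum>k<n. (t gchoose k) * (u ^ k - w ^ k)) \<le> real p * padic_abs (u - w)" for n
    by (intro pabs_sum) auto
  then show "padic_abs ((\<Sum>k<n. (t gchoose k) * u ^ k) + (- 1) * (\<Sum>k<n. (t gchoose k) * w ^ k))
      \<le> real p * padic_abs (u - w)" for n
    by (simp add: right_diff_distrib sum_subtractf)
qed

text \<open>Vandermonde's convolution evaluates the coefficients of the Cauchy product. It later
  shows that the powers with exponents \<open>t\<close> and \<open>- t\<close> are inverse to each
  other.\<close>

lemma binomial_series_exponent_add:
  fixes s t u w :: 'a
  assumes "padic_abs s \<le> M" "padic_abs t \<le> M" "padic_abs (s + t) \<le> M" "padic_abs u \<le> 1 / real p"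
  shows "binomial_series (s + t) u = binomial_series s u * binomial_series t u"
proof -
  have "(\<lambda>n. \<Sum>i\<le>n. (s gchoose i) * u ^ i * ((t gchoose (n - i)) * u ^ (n - i)))
      sums (binomial_series s u * binomial_series t u)"
    unfolding binomial_series_def
    using binomial_series_term assms rate_nonneg rate_less_1 by (intro sums_mult_pabs) auto
  moreover have "(\<Sum>i\<le>n. (s gchoose i) * u ^ i * ((t gchoose (n - i)) * u ^ (n - i)))
      = (s + t gchoose n) * u ^ n" for n
  proof -
    have "(\<Sum>i\<le>n. (s gchoose i) * u ^ i * ((t gchoose (n - i)) * u ^ (n - i)))
        = (\<Sum>i\<le>n. (s gchoose i) * (t gchoose (n - i)) * u ^ n)"
      by (intro sum.cong refl) (simp add: mult_ac flip: power_add)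
    then show ?thesis
      by (simp add: gbinomial_Vandermonde[symmetric] atLeast0AtMost sum_distrib_right)
  qed
  ultimately show ?thesis
    using binomial_series_sums[OF assms(3,4)] sums_unique2 by simp
qed

lemma binomial_series_0 [simp]: "binomial_series 0 u = 1"
proof -
  have "(\<lambda>k. (0 gchoose k) * u ^ k) = (\<lambda>k. if k = 0 then 1 else 0)"
    by (auto simp: gbinomial_0_left)
  then show ?thesis
    using sums_single[of 0 "\<lambda>_. 1 :: 'a"] by (simp add: binomial_series_def sums_iff)
qed

text \<open>The law \<open>(1 + u)^t (1 + w)^t = ((1 + u) (1 + w))^t\<close>. Expanding the powers
  of \<open>u + w + u w\<close> by degree in \<open>u\<close> and \<open>w\<close> gives a double
  array \<open>a k n\<close>: its rows sum to the terms of the left series, its columns to the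
  Cauchy product of the right ones by \<open>gbinomial_mult_coeff\<close>.\<close>

lemma binomial_series_mult:
  fixes s t u w :: 'a
  assumes "padic_abs t \<le> M" "padic_abs u \<le> 1 / real p" "padic_abs w \<le> 1 / real p"
  shows "binomial_series t (u + w + u * w) = binomial_series t u * binomial_series t w"
proof -
  let ?A = "[:0, u + w, u * w:]"
  define a where "a = (\<lambda>k n. (t gchoose k) * coeff (?A ^ k) n)"
  have uw: "padic_abs (u + w) \<le> 1 / real p"
    using pabs_add[of u w] assms by simp
  have prod: "padic_abs (u * w) \<le> (1 / real p)\<^sup>2"
    using mult_mono[OF assms(2,3)] by (simp add: pabs_mult power2_eq_square)
  also have "\<dots> \<le> 1 / real p"
    using p_gt_1 by (simp add: power2_eq_square field_simps)
  finally have A1: "padic_abs (u + w + u * w) \<le> 1 / real p"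
    using pabs_add[of "u + w" "u * w"] uw by simp
  have coeff_A: "padic_abs (coeff ?A n) \<le> (1 / real p) ^ n" for n
    using uw prod p_gt_1 by (auto simp: coeff_pCons power2_eq_square split: nat.split)
  have a_le: "padic_abs (a k n) \<le> (M * fact_root) ^ k * (1 / real p) ^ n" for k n
    unfolding a_def pabs_mult
    using pabs_gbinomial[OF assms(1) M_ge_1] pabs_coeff_power[OF coeff_A] M_fact_root_ge_1
    by (intro mult_mono) auto
  have prod_series: "(\<lambda>n. \<Sum>i\<le>n. (t gchoose i) * u ^ i * ((t gchoose (n - i)) * w ^ (n - i)))
      sums (binomial_series t u * binomial_series t w)"
    unfolding binomial_series_def
    using binomial_series_term assms rate_nonneg rate_less_1 by (intro sums_mult_pabs) auto
  have "(\<lambda>k. (t gchoose k) * (u + w + u * w) ^ k) sums (binomial_series t u * binomial_series t w)"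
    unfolding sums_def
  proof (rule tendsto_padic_perturb)
    show "(\<lambda>K. \<Sum>n<K. \<Sum>i\<le>n. (t gchoose i) * u ^ i * ((t gchoose (n - i)) * w ^ (n - i)))
        \<longlonglongrightarrow> binomial_series t u * binomial_series t w"
      using prod_series by (simp add: sums_def)
    show "(\<lambda>K. rate ^ K) \<longlonglongrightarrow> 0"
      using rate_nonneg rate_less_1 by (intro LIMSEQ_power_zero) auto
    fix K
    \<comment> \<open>Evaluation at 1 sums all coefficients of \<open>A ^ k\<close>. Its degree is
      at most \<open>2 k\<close>, so the columns below \<open>2 K\<close> hold every row
      \<open>k < K\<close> completely.\<close>
    have "(t gchoose k) * (u + w + u * w) ^ k = (\<Sum>n<2 * K. a k n)" if "k < K" for k
    proof -
      have "degree (?A ^ k) \<le> degree ?A * k"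
        by (rule degree_power_le)
      also have "\<dots> \<le> 2 * k"
        by (intro mult_right_mono) auto
      finally have deg: "degree (?A ^ k) < 2 * K"
        using that by simp
      have "(u + w + u * w) ^ k = poly (?A ^ k) 1"
        by (simp add: poly_power add.assoc)
      also have "\<dots> = (\<Sum>n\<le>degree (?A ^ k). coeff (?A ^ k) n)"
        by (simp add: poly_altdef)
      also have "\<dots> = (\<Sum>n<2 * K. coeff (?A ^ k) n)"
        using deg by (intro sum.mono_neutral_left) (auto simp: coeff_eq_0)
      finally show ?thesis
        by (simp add: a_def sum_distrib_left)
    qed
    then have "(\<Sum>k<K. (t gchoose k) * (u + w + u * w) ^ k) = (\<Sum>k<K. \<Sum>n<2 * K. a k n)"
      by (intro sum.cong) auto
    also have "\<dots> = (\<Sum>n<2 * K. \<Sum>k<K. a k n)"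
      by (rule sum.swap)
    \<comment> \<open>The columns \<open>n < K\<close> are already exact Cauchy coefficients; those
      from \<open>K\<close> on are cut off by \<open>k < K\<close> and form the error.\<close>
    also have "{..<2 * K} = {..<K} \<union> {K..<2 * K}"
      by auto
    also have "(\<Sum>n\<in>\<dots>. \<Sum>k<K. a k n) = (\<Sum>n<K. \<Sum>k<K. a k n) + (\<Sum>n\<in>{K..<2 * K}. \<Sum>k<K. a k n)"
      by (rule sum.union_disjoint) auto
    also have "(\<Sum>n<K. \<Sum>k<K. a k n)
        = (\<Sum>n<K. \<Sum>i\<le>n. (t gchoose i) * u ^ i * ((t gchoose (n - i)) * w ^ (n - i)))"
      unfolding a_def by (intro sum.cong refl gbinomial_mult_coeff) auto
    finally have "(\<Sum>k<K. (t gchoose k) * (u + w + u * w) ^ k)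
        - (\<Sum>n<K. \<Sum>i\<le>n. (t gchoose i) * u ^ i * ((t gchoose (n - i)) * w ^ (n - i)))
        = (\<Sum>n\<in>{K..<2 * K}. \<Sum>k<K. a k n)"
      by simp
    moreover have "padic_abs (\<Sum>n\<in>{K..<2 * K}. \<Sum>k<K. a k n) \<le> rate ^ K"
    proof (intro pabs_sum)
      fix n k assume "n \<in> {K..<2 * K}" "k \<in> {..<K}"
      then have nk: "k \<le> n" "K \<le> n"
        by auto
      \<comment> \<open>As \<open>M * fact_root\<close> is at least 1 and \<open>k \<le> n\<close>,
        the exponent can be raised to \<open>n\<close>, which leaves a power of
        \<open>rate\<close>.\<close>
      have "(M * fact_root) ^ k * (1 / real p) ^ n \<le> (M * fact_root) ^ n * (1 / real p) ^ n"
        using M_fact_root_ge_1 nk by (intro mult_right_mono power_increasing) auto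
      also have "\<dots> = rate ^ n"
        by (simp add: rate_def power_divide power_one_over)
      also have "\<dots> \<le> rate ^ K"
        using rate_nonneg rate_less_1 nk by (intro power_decreasing) auto
      finally show "padic_abs (a k n) \<le> rate ^ K"
        using a_le[of k n] by simp
    qed (use rate_nonneg in auto)
    ultimately show "padic_abs ((\<Sum>k<K. (t gchoose k) * (u + w + u * w) ^ k)
        - (\<Sum>n<K. \<Sum>i\<le>n. (t gchoose i) * u ^ i * ((t gchoose (n - i)) * w ^ (n - i)))) \<le> rate ^ K"
      by simp
  qed
  then show ?thesis
    using binomial_series_sums[OF assms(1) A1] sums_unique2 by blast
qed

end

section \<open>The fermionic integral\<close>

lemma sum_lessThan_mult:
  fixes g :: "nat \<Rightarrow> 'b::comm_monoid_add"
  shows "sum g {..<n * k} = (\<Sum>m<n. \<Sum>i<k. g (m * k + i))"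
proof -
  have "sum g {m * k..<m * k + k} = (\<Sum>i<k. g (m * k + i))" for m
    using sum.shift_bounds_nat_ivl[of g 0 "m * k" k]
    by (simp add: add.commute atLeast0LessThan)
  then show ?thesis
    by (simp flip: sum.nat_group)
qed

lemma sum_alternating_telescope:
  fixes g :: "nat \<Rightarrow> 'b::comm_ring_1"
  shows "(\<Sum>a<n. (-1) ^ a * (g (Suc a) + g a)) = g 0 - (-1) ^ n * g n"
  by (induction n) (auto simp: algebra_simps)

lemma sum_alternating_odd:
  assumes "odd r"
  shows "(\<Sum>d<r. (-1) ^ d) = (1 :: 'b::comm_ring_1)"
proof -
  obtain k where "r = Suc (2 * k)"
    using assms by (auto elim: oddE)
  moreover have "(\<Sum>d<Suc (2 * k). (-1) ^ d) = (1 :: 'b)"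
    by (induction k) auto
  ultimately show ?thesis
    by simp
qed

locale padic_lipschitz = padic_valued_field p ty
  for p :: nat and ty :: "'a::{field_char_0,complete_space} itself" +
  fixes f :: "'a \<Rightarrow> 'a" and C :: real
  assumes odd_p: "odd p"
    and lipschitz: "\<And>y y'. y \<in> padic_ints \<Longrightarrow> y' \<in> padic_ints \<Longrightarrow>
      padic_abs (f y - f y') \<le> C * padic_abs (y - y')"
    and C_nonneg: "C \<ge> 0"
begin

lemma lipschitz_p_power:
  assumes "y \<in> padic_ints" "y' \<in> padic_ints" "padic_abs (y - y') \<le> 1 / real p ^ M"
  shows "padic_abs (f y - f y') \<le> C / real p ^ M"
  using order_trans[OF lipschitz[OF assms(1,2)] mult_left_mono[OF assms(3) C_nonneg]] by simp

lemma pabs_mult_p_power: "padic_abs (of_nat d * of_nat p ^ M :: 'a) \<le> 1 / real p ^ M"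
  using mult_right_mono[OF pabs_of_nat[of d], of "1 / real p ^ M"] p_gt_1
  by (simp add: pabs_mult pabs_p_power)

lemma pabs_minus_one_power: "padic_abs ((-1) ^ n :: 'a) = 1"
  by (simp add: pabs_power)

lemma pabs_block_sum:
  assumes "odd r" "x \<in> padic_ints"
  shows "padic_abs ((\<Sum>b<r * p ^ M. (-1) ^ b * f (x + of_nat b)) - (\<Sum>a<p ^ M. (-1) ^ a * f (x + of_nat a)))
    \<le> C / real p ^ M"
proof -
  \<comment> \<open>The short sum is written \<open>r\<close> times with alternating signs, so that
    it can be compared block by block with the long one.\<close>
  have "(\<Sum>a<p ^ M. (-1) ^ a * f (x + of_nat a))
      = (\<Sum>d<r. (-1) ^ d) * (\<Sum>a<p ^ M. (-1) ^ a * f (x + of_nat a))"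
    by (simp add: sum_alternating_odd assms(1))
  also have "\<dots> = (\<Sum>d<r. \<Sum>a<p ^ M. (-1) ^ (d + a) * f (x + of_nat a))"
    by (simp add: sum_product power_add mult.assoc)
  \<comment> \<open>As \<open>p ^ M\<close> is odd, the sign at \<open>d * p ^ M + a\<close> depends
    only on the parity of \<open>d + a\<close>.\<close>
  moreover have "(\<Sum>b<r * p ^ M. (-1) ^ b * f (x + of_nat b))
      = (\<Sum>d<r. \<Sum>a<p ^ M. (-1) ^ (d + a) * f (x + of_nat (d * p ^ M + a)))"
    unfolding sum_lessThan_mult using odd_p
    by (intro sum.cong refl arg_cong2[of _ _ _ _ "(*)"]) (simp_all add: minus_one_power_iff)
  ultimately have "(\<Sum>b<r * p ^ M. (-1) ^ b * f (x + of_nat b)) - (\<Sum>a<p ^ M. (-1) ^ a * f (x + of_nat a))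
      = (\<Sum>d<r. \<Sum>a<p ^ M. (-1) ^ (d + a) * (f (x + of_nat (d * p ^ M + a)) - f (x + of_nat a)))"
    by (simp add: sum_subtractf right_diff_distrib)
  also have "padic_abs \<dots> \<le> C / real p ^ M"
  proof (intro pabs_sum)
    fix d a
    have "padic_abs (f (x + of_nat (d * p ^ M + a)) - f (x + of_nat a)) \<le> C / real p ^ M"
    proof (rule lipschitz_p_power)
      show "padic_abs (x + of_nat (d * p ^ M + a) - (x + of_nat a)) \<le> 1 / real p ^ M"
        using pabs_mult_p_power[of d M] by simp
    qed (intro padic_ints_add of_nat_padic_ints assms)+
    then show "padic_abs ((-1) ^ (d + a) * (f (x + of_nat (d * p ^ M + a)) - f (x + of_nat a)))
        \<le> C / real p ^ M"
      unfolding pabs_mult pabs_minus_one_power by simp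
  qed (use C_nonneg in auto)
  finally show ?thesis .
qed

text \<open>The block estimate with \<open>r = p\<close> compares the sums of lengths
  \<open>p ^ M\<close> and \<open>p ^ (M + 1)\<close>, so the total operator \<open>lim\<close>
  denotes a genuine limit here.\<close>

lemma fermionic_integral_LIMSEQ:
  assumes "x \<in> padic_ints"
  shows "(\<lambda>M. \<Sum>a<p ^ M. (-1) ^ a * f (x + of_nat a)) \<longlonglongrightarrow> fermionic_integral p (\<lambda>a. f (x + a))"
proof -
  have "convergent (\<lambda>M. \<Sum>a<p ^ M. (-1) ^ a * f (x + of_nat a))"
    using pabs_block_sum[OF odd_p assms] C_nonneg
    by (intro convergent_padicI[OF _ decseq_inverse_p_power inverse_p_power_LIMSEQ]) simp_all
  then show ?thesis
    unfolding fermionic_integral_def by (rule convergent_LIMSEQ_iff[THEN iffD1])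
qed

lemma fermionic_integral_shift:
  assumes "x \<in> padic_ints"
  shows "fermionic_integral p (\<lambda>a. f (x + 1 + a)) + fermionic_integral p (\<lambda>a. f (x + a)) = 2 * f x"
proof -
  let ?S = "\<lambda>x M. \<Sum>a<p ^ M. (-1) ^ a * f (x + of_nat a)"
  have eq: "?S (x + 1) M + ?S x M = f x + f (x + of_nat (p ^ M))" for M
  proof -
    have "?S (x + 1) M + ?S x M
        = (\<Sum>a<p ^ M. (-1) ^ a * (f (x + of_nat (Suc a)) + f (x + of_nat a)))"
      by (simp add: distrib_left sum.distrib add.assoc)
    \<comment> \<open>The upper boundary term of the telescoping sum enters with a plus sign because
      \<open>p ^ M\<close> is odd; it tends to \<open>f x\<close>.\<close>
    also have "\<dots> = f x + f (x + of_nat (p ^ M))"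
      unfolding sum_alternating_telescope[of "\<lambda>a. f (x + of_nat a)"]
      using odd_p by (simp add: minus_one_power_iff)
    finally show ?thesis .
  qed
  have "(\<lambda>M. ?S (x + 1) M + ?S x M)
      \<longlonglongrightarrow> fermionic_integral p (\<lambda>a. f (x + 1 + a)) + fermionic_integral p (\<lambda>a. f (x + a))"
    using assms by (intro tendsto_padic_add fermionic_integral_LIMSEQ padic_ints_add) auto
  moreover have "(\<lambda>M. ?S (x + 1) M + ?S x M) \<longlonglongrightarrow> 2 * f x"
    unfolding eq
  proof (rule tendsto_padic_perturb[OF tendsto_const _ inverse_p_power_LIMSEQ])
    fix M
    have "padic_abs (f (x + of_nat (p ^ M)) - f x) \<le> C / real p ^ M"
      using assms pabs_mult_p_power[of 1 M] by (intro lipschitz_p_power padic_ints_add) (auto simp flip: of_nat_power)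
    then show "padic_abs (f x + f (x + of_nat (p ^ M)) - 2 * f x) \<le> C / real p ^ M"
      by (simp add: algebra_simps)
  qed
  ultimately show ?thesis
    by (rule LIMSEQ_unique)
qed

lemma fermionic_integral_reflect:
  assumes "x \<in> padic_ints" "\<And>y. y \<in> padic_ints \<Longrightarrow> f (- y) = c * f y"
  shows "fermionic_integral p (\<lambda>a. f (1 - x + a)) = c * fermionic_integral p (\<lambda>a. f (x + a))"
proof -
  let ?S = "\<lambda>x M. \<Sum>a<p ^ M. (-1) ^ a * f (x + of_nat a)"
  \<comment> \<open>Reversing the summation turns \<open>1 - x + a\<close> into
    \<open>- (x + a - p ^ M)\<close>. The signs are unchanged since \<open>p ^ M - 1\<close> is
    even, and the shift by \<open>p ^ M\<close> vanishes in the limit.\<close>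
  have eq: "?S (1 - x) M = c * (\<Sum>a<p ^ M. (-1) ^ a * f (x + of_nat a - of_nat p ^ M))" for M
  proof -
    have "?S (1 - x) M = (\<Sum>a<p ^ M. (-1) ^ (p ^ M - Suc a) * f (1 - x + of_nat (p ^ M - Suc a)))"
      by (rule sum.nat_diff_reindex[symmetric])
    also have "\<dots> = (\<Sum>a<p ^ M. c * ((-1) ^ a * f (x + of_nat a - of_nat p ^ M)))"
    proof (intro sum.cong refl)
      fix a assume "a \<in> {..<p ^ M}"
      then have le: "Suc a \<le> p ^ M"
        by simp
      have "even (p ^ M - Suc a) \<longleftrightarrow> even a"
        using le odd_p by auto
      then have sign: "(-1) ^ (p ^ M - Suc a) = ((-1) ^ a :: 'a)"
        by (simp add: minus_one_power_iff)
      have arg: "1 - x + of_nat (p ^ M - Suc a) = - (x + of_nat a - of_nat (p ^ M))"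
        using le by (simp add: of_nat_diff)
      have "x + of_nat a - of_nat (p ^ M) \<in> padic_ints"
        using assms(1) by (intro padic_ints_diff padic_ints_add of_nat_padic_ints)
      then show "(-1) ^ (p ^ M - Suc a) * f (1 - x + of_nat (p ^ M - Suc a))
          = c * ((-1) ^ a * f (x + of_nat a - of_nat p ^ M))"
        unfolding arg sign using assms(2) by (simp only: of_nat_power mult_ac)
    qed
    finally show ?thesis
      by (simp add: sum_distrib_left)
  qed
  have "?S (1 - x) \<longlonglongrightarrow> fermionic_integral p (\<lambda>a. f (1 - x + a))"
    using assms(1) by (intro fermionic_integral_LIMSEQ padic_ints_diff) auto
  moreover have "?S (1 - x) \<longlonglongrightarrow> c * fermionic_integral p (\<lambda>a. f (x + a))"
    unfolding eq
  proof (intro tendsto_padic_mult_left tendsto_padic_perturb[OF fermionic_integral_LIMSEQ[OF assms(1)] _ inverse_p_power_LIMSEQ])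
    fix M
    have "padic_abs (\<Sum>a<p ^ M. (-1) ^ a * (f (x + of_nat a - of_nat (p ^ M)) - f (x + of_nat a)))
        \<le> C / real p ^ M"
    proof (intro pabs_sum)
      fix a
      have "padic_abs (f (x + of_nat a - of_nat (p ^ M)) - f (x + of_nat a)) \<le> C / real p ^ M"
        using assms(1) by (intro lipschitz_p_power padic_ints_diff padic_ints_add of_nat_padic_ints)
          (auto simp: pabs_p_power)
      then show "padic_abs ((-1) ^ a * (f (x + of_nat a - of_nat (p ^ M)) - f (x + of_nat a)))
          \<le> C / real p ^ M"
        unfolding pabs_mult pabs_minus_one_power by simp
    qed (use C_nonneg in auto)
    then show "padic_abs ((\<Sum>a<p ^ M. (-1) ^ a * f (x + of_nat a - of_nat p ^ M)) - ?S x M)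
        \<le> C / real p ^ M"
      by (simp add: right_diff_distrib sum_subtractf)
  qed
  ultimately show ?thesis
    by (rule LIMSEQ_unique)
qed

lemma fermionic_integral_distribution:
  assumes "x \<in> padic_ints" "odd N" "\<not> p dvd N"
    and scale: "\<And>z. z \<in> padic_ints \<Longrightarrow> f (z / of_nat N) = c * f z"
  shows "(\<Sum>i<N. fermionic_integral p (\<lambda>a. f (x + of_nat i / of_nat N + a)) * (-1) ^ i)
    = c * fermionic_integral p (\<lambda>a. f (of_nat N * x + a))"
proof -
  let ?S = "\<lambda>x M. \<Sum>a<p ^ M. (-1) ^ a * f (x + of_nat a)"
  have N: "of_nat N \<noteq> (0 :: 'a)"
    using assms(2) by (metis odd_pos of_nat_eq_0_iff less_irrefl)
  have xN: "x + of_nat i / of_nat N \<in> padic_ints" for i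
    unfolding divide_inverse
    using assms(1) inverse_of_nat_padic_ints[OF assms(3)]
    by (intro padic_ints_add padic_ints_mult) auto
  have Nx: "of_nat N * x \<in> padic_ints"
    using assms(1) by (intro padic_ints_mult) auto
  \<comment> \<open>The pairs \<open>(i, a)\<close> enumerate \<open>b = a N + i\<close> below
    \<open>N p ^ M\<close>, and \<open>x + i / N + a = (N x + b) / N\<close>. Oddness of
    \<open>N\<close> makes the signs multiply to that of \<open>b\<close>.\<close>
  have eq: "(\<Sum>i<N. (-1) ^ i * ?S (x + of_nat i / of_nat N) M)
      = c * (\<Sum>b<N * p ^ M. (-1) ^ b * f (of_nat N * x + of_nat b))" for M
  proof -
    have "(\<Sum>i<N. (-1) ^ i * ?S (x + of_nat i / of_nat N) M)
        = (\<Sum>i<N. \<Sum>a<p ^ M. c * ((-1) ^ (a * N + i) * f (of_nat N * x + of_nat (a * N + i))))"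
      unfolding sum_distrib_left
    proof (intro sum.cong refl)
      fix i a
      have "x + of_nat i / of_nat N + of_nat a = (of_nat N * x + of_nat (a * N + i)) / of_nat N"
        using N by (simp add: field_simps)
      moreover have "of_nat N * x + of_nat (a * N + i) \<in> padic_ints"
        using Nx by (intro padic_ints_add of_nat_padic_ints)
      moreover have "(-1) ^ (a * N + i) = (-1) ^ i * ((-1) ^ a :: 'a)"
        using assms(2) by (simp add: minus_one_power_iff)
      ultimately show "(-1) ^ i * ((-1) ^ a * f (x + of_nat i / of_nat N + of_nat a))
          = c * ((-1) ^ (a * N + i) * f (of_nat N * x + of_nat (a * N + i)))"
        by (simp only: scale mult_ac)
    qed
    also have "\<dots> = c * (\<Sum>a<p ^ M. \<Sum>i<N. (-1) ^ (a * N + i) * f (of_nat N * x + of_nat (a * N + i)))"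
      unfolding sum_distrib_left by (rule sum.swap)
    also have "\<dots> = c * (\<Sum>b<N * p ^ M. (-1) ^ b * f (of_nat N * x + of_nat b))"
      by (simp only: sum_lessThan_mult[symmetric, of "\<lambda>b. (-1) ^ b * f (of_nat N * x + of_nat b)"] mult.commute[of N])
    finally show ?thesis .
  qed
  have "(\<lambda>M. \<Sum>i<N. (-1) ^ i * ?S (x + of_nat i / of_nat N) M)
      \<longlonglongrightarrow> (\<Sum>i<N. (-1) ^ i * fermionic_integral p (\<lambda>a. f (x + of_nat i / of_nat N + a)))"
    by (intro tendsto_padic_sum tendsto_padic_mult_left fermionic_integral_LIMSEQ xN)
  \<comment> \<open>The block estimate with \<open>r = N\<close> replaces the length
    \<open>N p ^ M\<close> by \<open>p ^ M\<close>.\<close>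
  moreover have "(\<lambda>M. \<Sum>i<N. (-1) ^ i * ?S (x + of_nat i / of_nat N) M)
      \<longlonglongrightarrow> c * fermionic_integral p (\<lambda>a. f (of_nat N * x + a))"
    unfolding eq using pabs_block_sum[OF assms(2) Nx]
    by (intro tendsto_padic_mult_left
        tendsto_padic_perturb[OF fermionic_integral_LIMSEQ[OF Nx] _ inverse_p_power_LIMSEQ])
  ultimately show ?thesis
    using LIMSEQ_unique by (simp add: mult.commute)
qed

end

section \<open>The zeta function\<close>

text \<open>The exponent \<open>t\<close> stands for \<open>1 - s\<close>, which is why the zeta
  function is taken at \<open>1 - t\<close> below.\<close>

locale padic_character = padic_exponent p ty M
  for p :: nat and ty :: "'a::{field_char_0,complete_space} itself" and M :: real +
  fixes v :: nat and chi :: "int \<Rightarrow> 'a" and t :: 'a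
  assumes odd_p: "odd p" and v_pos: "v \<ge> 1"
    and character: "dirichlet_character (p ^ v) chi"
    and t_le: "padic_abs t \<le> M"
begin

section \<open>The character and its extension to the p-adic integers\<close>

lemma chi_mult: "chi (a * b) = chi a * chi b"
  and chi_1 [simp]: "chi 1 = 1"
  and chi_eq_0_iff: "chi a = 0 \<longleftrightarrow> \<not> coprime a (int (p ^ v))"
  using character unfolding dirichlet_character_def by blast+

lemma chi_eq_0_iff_dvd: "chi a = 0 \<longleftrightarrow> int p dvd a"
proof -
  have "coprime a (int p) \<longleftrightarrow> \<not> int p dvd a"
    using prime_p prime_imp_coprime[of "int p" a] by (auto simp: coprime_commute)
  then show ?thesis
    using v_pos by (auto simp: chi_eq_0_iff)
qed

lemma chi_power: "chi (a ^ n) = chi a ^ n"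
  by (induction n) (auto simp: chi_mult)

lemma chi_cong:
  assumes "int (p ^ v) dvd a - b"
  shows "chi a = chi b"
proof -
  have period: "chi (b + int (p ^ v) * int k) = chi b" for b k
  proof (induction k)
    case (Suc k)
    have "chi (b + int (p ^ v) * int (Suc k)) = chi (b + int (p ^ v) * int k + int (p ^ v))"
      by (simp add: algebra_simps)
    then show ?case
      using character Suc unfolding dirichlet_character_def by simp
  qed auto
  obtain k where k: "a - b = int (p ^ v) * k"
    using assms ..
  show ?thesis
  proof (cases "k \<ge> 0")
    case True
    then show ?thesis
      using period[of b "nat k"] k by (simp add: algebra_simps)
  next
    \<comment> \<open>Periodicity is proved for natural multiples only; a negative multiple is
      treated by exchanging \<open>a\<close> and \<open>b\<close>.\<close>
    case False
    then show ?thesis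
      using period[of a "nat (- k)"] k by (simp add: algebra_simps)
  qed
qed

text \<open>By Euler's theorem every nonzero value of \<open>chi\<close> is a root of unity.\<close>

lemma pabs_chi: "padic_abs (chi a) \<le> 1"
proof (cases "chi a = 0")
  case False
  define m where "m = nat (a mod int (p ^ v))"
  have pv: "p ^ v > 0"
    using prime_gt_0_nat[OF prime_p] by simp
  have "int m = a mod int (p ^ v)"
    using pv by (simp add: m_def)
  then have "int (p ^ v) dvd a - int m"
    by (simp add: minus_mod_eq_mult_div)
  then have chi_m: "chi a = chi (int m)"
    by (rule chi_cong)
  then have "coprime (int m) (int (p ^ v))"
    using False chi_eq_0_iff by auto
  then have "coprime m (p ^ v)"
    by (simp only: coprime_int_iff)
  then have "[m ^ totient (p ^ v) = 1] (mod p ^ v)"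
    by (rule euler_theorem)
  then have "[int (m ^ totient (p ^ v)) = int 1] (mod int (p ^ v))"
    by (simp only: cong_int_iff)
  then have "chi (int m ^ totient (p ^ v)) = chi 1"
    by (intro chi_cong) (simp add: cong_iff_dvd_diff)
  then have "chi a ^ totient (p ^ v) = 1"
    by (simp add: chi_m chi_power)
  then show ?thesis
    using pv by (simp add: pabs_root_of_unity[of _ "totient (p ^ v)"])
qed auto

text \<open>All integers close to \<open>y\<close> are congruent modulo \<open>p ^ v\<close>, so the
  choice made by \<open>SOME\<close> does not affect the value.\<close>

lemma character_ext_eq:
  assumes "y \<in> padic_ints" "padic_abs (y - of_int n) \<le> 1 / real p ^ v"
  shows "character_ext (p ^ v) chi y = chi n"
proof -
  have cong_iff: "padic_cong y (of_int k) (p ^ v) \<longleftrightarrow> padic_abs (y - of_int k) \<le> 1 / real p ^ v" for k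
    using assms(1) by (rule padic_cong_iff_pabs) simp
  show ?thesis
    unfolding character_ext_def
  proof (rule someI2)
    show "padic_cong y (of_int n) (p ^ v)"
      using assms(2) cong_iff by blast
  next
    fix k assume "padic_cong y (of_int k) (p ^ v)"
    then have "padic_abs (of_int k - y) \<le> 1 / real p ^ v"
      by (simp add: cong_iff pabs_minus_commute)
    then have "padic_abs (of_int k - of_int n :: 'a) \<le> 1 / real p ^ v"
      using assms(2) by (rule pabs_diff_trans)
    then have "int (p ^ v) dvd k - n"
      using pabs_of_int_le_iff[of "k - n" v] by simp
    then show "chi k = chi n"
      by (rule chi_cong)
  qed
qed

lemma character_ext_of_int [simp]: "character_ext (p ^ v) chi (of_int n) = chi n"
  using p_gt_1 by (intro character_ext_eq) auto

lemma character_ext_mult: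
  assumes "y \<in> padic_ints" "z \<in> padic_ints"
  shows "character_ext (p ^ v) chi (y * z) = character_ext (p ^ v) chi y * character_ext (p ^ v) chi z"
proof -
  obtain m where m: "padic_abs (y - of_int m) \<le> 1 / real p ^ v"
    using assms(1) by (rule padic_ints_approx)
  obtain n where n: "padic_abs (z - of_int n) \<le> 1 / real p ^ v"
    using assms(2) by (rule padic_ints_approx)
  have "padic_abs (y * z - of_int m * z) \<le> 1 / real p ^ v"
    using mult_mono[OF m pabs_padic_ints[OF assms(2)]] p_gt_1
    by (simp add: pabs_mult flip: left_diff_distrib)
  moreover have "padic_abs (of_int m * z - of_int m * of_int n) \<le> 1 / real p ^ v"
    using mult_mono[OF pabs_of_int[of m] n] p_gt_1
    by (simp add: pabs_mult flip: right_diff_distrib)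
  ultimately have "padic_abs (y * z - of_int m * of_int n) \<le> 1 / real p ^ v"
    by (rule pabs_diff_trans)
  then have "character_ext (p ^ v) chi (y * z) = chi (m * n)"
    using assms by (intro character_ext_eq padic_ints_mult) auto
  then show ?thesis
    using assms m n by (simp add: chi_mult character_ext_eq)
qed

text \<open>An approximating integer has absolute value 1 and lies at distance below 1 from
  \<open>y\<close>. Off the units the integrand is therefore 0, and \<open>angle_power\<close>
  matters only where its series is controlled.\<close>

lemma character_ext_nonzero_unit:
  assumes "y \<in> padic_ints" "character_ext (p ^ v) chi y \<noteq> 0"
  shows "y \<in> padic_units"
proof -
  obtain n where n: "padic_abs (y - of_int n) \<le> 1 / real p ^ v"
    using assms(1) by (rule padic_ints_approx)
  have "chi n \<noteq> 0"
    using assms(2) character_ext_eq[OF assms(1) n] by simp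
  then have "padic_abs (of_int n :: 'a) = 1"
    using chi_eq_0_iff_dvd pabs_of_int_coprime by blast
  moreover have "1 / real p ^ v < 1"
    using p_gt_1 v_pos by (simp add: one_less_power)
  ultimately have "\<not> padic_abs y < 1"
    using pabs_diff[of y "y - of_int n"] n by auto
  then show ?thesis
    using pabs_padic_ints[OF assms(1)] assms(1) by (auto simp: padic_units_def)
qed

lemma pabs_character_ext:
  assumes "y \<in> padic_ints"
  shows "padic_abs (character_ext (p ^ v) chi y) \<le> 1"
proof -
  obtain n where "padic_abs (y - of_int n) \<le> 1 / real p ^ v"
    using assms by (rule padic_ints_approx)
  then show ?thesis
    using character_ext_eq[OF assms] pabs_chi by simp
qed

section \<open>The integrand: multiplicativity, parity and continuity\<close>

lemma angle_power_mult:
  assumes "y \<in> padic_units" "z \<in> padic_units"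
  shows "angle_power p (y * z) t = angle_power p y t * angle_power p z t"
proof -
  let ?u = "padic_angle p y - 1" and ?w = "padic_angle p z - 1"
  have "padic_angle p (y * z) - 1 = ?u + ?w + ?u * ?w"
    by (simp add: padic_angle_mult assms algebra_simps)
  then have "angle_power p (y * z) t = binomial_series t (?u + ?w + ?u * ?w)"
    by (simp only: angle_power_eq)
  then show ?thesis
    unfolding angle_power_eq
    by (simp only: binomial_series_mult[OF t_le] pabs_angle_minus_1 assms)
qed

definition integrand :: "'a \<Rightarrow> 'a"
  where "integrand y = character_ext (p ^ v) chi y * angle_power p y t"

lemma integrand_mult:
  assumes "y \<in> padic_ints" "z \<in> padic_ints"
  shows "integrand (y * z) = integrand y * integrand z"
proof (cases "character_ext (p ^ v) chi y = 0 \<or> character_ext (p ^ v) chi z = 0")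
  case True
  then show ?thesis
    using assms by (auto simp: integrand_def character_ext_mult)
next
  case False
  then show ?thesis
    using assms character_ext_nonzero_unit
    by (simp add: integrand_def character_ext_mult angle_power_mult)
qed

lemma integrand_uminus:
  assumes "y \<in> padic_ints"
  shows "integrand (- y) = chi (- 1) * integrand y"
proof -
  have ext: "character_ext (p ^ v) chi (- y) = chi (- 1) * character_ext (p ^ v) chi y"
    using character_ext_mult[OF of_int_padic_ints[of "-1"] assms] character_ext_of_int[of "-1"] by simp
  show ?thesis
  proof (cases "character_ext (p ^ v) chi y = 0")
    case False
    then have "y \<in> padic_units"
      using assms character_ext_nonzero_unit by blast
    then show ?thesis
      by (simp add: integrand_def ext angle_power_eq padic_angle_uminus odd_p)
  qed (simp add: integrand_def ext)
qed

lemma pabs_integrand: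
  assumes "y \<in> padic_ints"
  shows "padic_abs (integrand y) \<le> 1"
proof (cases "character_ext (p ^ v) chi y = 0")
  case False
  then have "padic_abs (angle_power p y t) \<le> 1"
    using assms t_le character_ext_nonzero_unit pabs_binomial_series pabs_angle_minus_1
    by (simp add: angle_power_eq)
  then show ?thesis
    using mult_mono[OF pabs_character_ext[OF assms]] by (simp add: integrand_def pabs_mult)
qed (simp add: integrand_def)

text \<open>Within distance \<open>1 / p ^ v\<close> the character is constant and the angle power
  is Lipschitz with constant \<open>p\<close>, at most \<open>p ^ v\<close>. At larger distances the
  claimed bound exceeds 1, which bounds both values.\<close>

lemma integrand_lipschitz:
  assumes "y \<in> padic_ints" "y' \<in> padic_ints"
  shows "padic_abs (integrand y - integrand y') \<le> real p ^ v * padic_abs (y - y')"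
proof (cases "padic_abs (y - y') \<le> 1 / real p ^ v")
  case True
  obtain n where n: "padic_abs (y' - of_int n) \<le> 1 / real p ^ v"
    using assms(2) by (rule padic_ints_approx)
  have ext: "character_ext (p ^ v) chi y = character_ext (p ^ v) chi y'"
    using character_ext_eq[OF assms(1) pabs_diff_trans[OF True n]] character_ext_eq[OF assms(2) n] by simp
  show ?thesis
  proof (cases "character_ext (p ^ v) chi y' = 0")
    case False
    then have units: "y \<in> padic_units" "y' \<in> padic_units"
      using assms character_ext_nonzero_unit ext by auto
    have pv: "real p \<le> real p ^ v"
      using p_gt_1 v_pos by (intro self_le_power) auto
    then have "1 / real p ^ v \<le> 1 / real p"
      using p_gt_1 by (intro divide_left_mono) auto
    then have close: "padic_abs (y - y') \<le> 1 / real p"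
      using True by simp
    have "integrand y - integrand y'
        = character_ext (p ^ v) chi y' * (angle_power p y t - angle_power p y' t)"
      by (simp add: integrand_def ext algebra_simps)
    then have "padic_abs (integrand y - integrand y')
        = padic_abs (character_ext (p ^ v) chi y') * padic_abs (angle_power p y t - angle_power p y' t)"
      by (simp only: pabs_mult)
    also have "\<dots> \<le> 1 * (real p * padic_abs (padic_angle p y - 1 - (padic_angle p y' - 1)))"
      unfolding angle_power_eq
      using pabs_binomial_series_diff[OF t_le units[THEN pabs_angle_minus_1]]
      by (intro mult_mono pabs_character_ext assms) auto
    also have "\<dots> = real p * padic_abs (y - y')"
      using pabs_angle_diff[OF units close] by simp
    also have "\<dots> \<le> real p ^ v * padic_abs (y - y')"
      using pv by (intro mult_right_mono) auto
    finally show ?thesis .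
  qed (simp add: integrand_def ext)
next
  case False
  then have "1 \<le> real p ^ v * padic_abs (y - y')"
    using p_gt_1 by (simp add: field_simps)
  moreover have "padic_abs (integrand y - integrand y') \<le> 1"
    using pabs_diff[of "integrand y" "integrand y'"] pabs_integrand[OF assms(1)]
      pabs_integrand[OF assms(2)] by simp
  ultimately show ?thesis
    by simp
qed

sublocale padic_lipschitz p ty integrand "real p ^ v"
  by unfold_locales (use odd_p integrand_lipschitz in auto)

lemma integrand_of_int: "integrand (of_int k) = chi k * angle_power p (of_int k) t"
  by (simp add: integrand_def)

lemma of_nat_padic_units:
  assumes "\<not> p dvd N"
  shows "of_nat N \<in> padic_units"
  using pabs_of_nat_coprime[OF assms] by (simp add: padic_units_def)

text \<open>Multiplicativity for \<open>z = N * (z / N)\<close>, solved for the last factor. The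
  inverse of \<open>angle_power p N t\<close> is the power with exponent \<open>- t\<close>, the
  additional factor in the distribution relation.\<close>

lemma integrand_divide:
  assumes "\<not> p dvd N" "z \<in> padic_ints" "padic_abs (- t) \<le> M"
  shows "integrand (z / of_nat N) = inverse (chi (int N)) * angle_power p (of_nat N) (- t) * integrand z"
proof -
  have N: "of_nat N \<in> padic_units" "of_nat N \<noteq> (0 :: 'a)"
    using of_nat_padic_units[OF assms(1)] assms(1) by (auto intro: Nat.gr0I)
  have chi: "chi (int N) \<noteq> 0"
    using assms(1) by (simp add: chi_eq_0_iff_dvd)
  have "z / of_nat N \<in> padic_ints"
    unfolding divide_inverse using assms inverse_of_nat_padic_ints by (intro padic_ints_mult) auto
  then have "integrand (of_nat N * (z / of_nat N)) = integrand (of_nat N) * integrand (z / of_nat N)"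
    by (intro integrand_mult) auto
  then have "integrand z = chi (int N) * angle_power p (of_nat N) t * integrand (z / of_nat N)"
    using N integrand_of_int[of "int N"] by simp
  moreover have "angle_power p (of_nat N) t * angle_power p (of_nat N) (- t) = 1"
    using binomial_series_exponent_add[OF t_le assms(3) _ pabs_angle_minus_1[OF N(1)]] M_ge_1
    by (simp add: angle_power_eq)
  ultimately show ?thesis
    using chi by (simp add: field_simps)
qed

lemma zeta_pE_eq: "zeta_pE p v chi (1 - t) x = fermionic_integral p (\<lambda>a. integrand (x + a))"
  by (simp add: zeta_pE_def integrand_def)

section \<open>Functional equations of the zeta function\<close>

lemma zeta_shift:
  assumes "x \<in> padic_ints"
  shows "zeta_pE p v chi (1 - t) (x + 1) + zeta_pE p v chi (1 - t) x = 2 * integrand x"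
  unfolding zeta_pE_eq using assms by (rule fermionic_integral_shift)

lemma zeta_reflect:
  assumes "x \<in> padic_ints"
  shows "zeta_pE p v chi (1 - t) (1 - x) = chi (- 1) * zeta_pE p v chi (1 - t) x"
  unfolding zeta_pE_eq using assms integrand_uminus by (rule fermionic_integral_reflect)

lemma zeta_distribution:
  assumes "x \<in> padic_ints" "odd N" "\<not> p dvd N" "padic_abs (- t) \<le> M"
  shows "(\<Sum>i<N. zeta_pE p v chi (1 - t) (x + of_nat i / of_nat N) * (-1) ^ i)
    = inverse (chi (int N)) * angle_power p (of_nat N) (- t) * zeta_pE p v chi (1 - t) (of_nat N * x)"
  unfolding zeta_pE_eq using assms integrand_divide by (intro fermionic_integral_distribution) auto

text \<open>At 0 the shift equation makes the values at 0 and 1 opposite, since the integrand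
  vanishes at 0, while reflection makes them equal.\<close>

lemma ell_pE_even:
  assumes "chi (- 1) = 1"
  shows "ell_pE p v chi (1 - t) = 0"
proof -
  have "chi 0 = 0"
    by (simp add: chi_eq_0_iff_dvd)
  then have "integrand 0 = 0"
    using integrand_of_int[of 0] by simp
  then show ?thesis
    using zeta_shift[of 0] zeta_reflect[of 0] assms by (simp add: ell_pE_def)
qed

text \<open>Reflection at 0 gives the value at 1, with an empty sum; the shift equation then drives
  the induction. Writing \<open>n = m + 1\<close> avoids truncated subtraction.\<close>

lemma zeta_of_nat:
  "zeta_pE p v chi (1 - t) (of_nat (Suc m)) = chi (- 1) *
    (2 * (\<Sum>j = 1..m. angle_power p (of_int (int j - int (Suc m))) t * chi (int j - int (Suc m)) * (-1) ^ (j + 1))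
      + (-1) ^ m * ell_pE p v chi (1 - t))"
proof (induction m)
  case 0
  show ?case
    using zeta_reflect[of 0] by (simp add: ell_pE_def)
next
  case (Suc m)
  define G where "G = (\<lambda>k. angle_power p (of_int k) t * chi k)"
  have G: "G k = integrand (of_int k)" for k
    by (simp add: G_def integrand_of_int)
  \<comment> \<open>\<open>chi (- 1)\<close> is its own inverse, which allows the shift term to be
    rewritten at a negative argument and \<open>chi (- 1)\<close> to be factored out.\<close>
  have chi_sq: "chi (- 1) * (chi (- 1) * y) = y" for y
    using chi_mult[of "-1" "-1"] by (simp flip: mult.assoc)
  have "G (- int (Suc m)) = chi (- 1) * integrand (of_nat (Suc m))"
    using integrand_uminus[OF of_nat_padic_ints[of "Suc m"]] by (simp add: G)
  then have F: "integrand (of_nat (Suc m)) = chi (- 1) * G (- int (Suc m))"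
    by (simp only: chi_sq)
  \<comment> \<open>After moving \<open>j\<close> down by one, the term \<open>j = 0\<close> is the
    new contribution of the shift equation; the rest is the previous sum with opposite sign.\<close>
  have "(\<Sum>j = 1..Suc m. G (int j - int (Suc (Suc m))) * (-1) ^ (j + 1))
      = (\<Sum>j<Suc m. G (int j - int (Suc m)) * (-1) ^ j)"
    unfolding One_nat_def sum.atLeast1_atMost_eq by (intro sum.cong refl) (simp add: algebra_simps)
  also have "\<dots> = G (- int (Suc m)) + (\<Sum>j<m. G (int (Suc j) - int (Suc m)) * (-1) ^ Suc j)"
    unfolding sum.lessThan_Suc_shift by simp
  also have "(\<Sum>j<m. G (int (Suc j) - int (Suc m)) * (-1) ^ Suc j)
      = - (\<Sum>j = 1..m. G (int j - int (Suc m)) * (-1) ^ (j + 1))"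
    unfolding One_nat_def sum.atLeast1_atMost_eq sum_negf[symmetric] by (intro sum.cong refl) simp
  finally have sum: "(\<Sum>j = 1..Suc m. G (int j - int (Suc (Suc m))) * (-1) ^ (j + 1))
      = G (- int (Suc m)) - (\<Sum>j = 1..m. G (int j - int (Suc m)) * (-1) ^ (j + 1))"
    by simp
  define S where "S = (\<Sum>j = 1..m. G (int j - int (Suc m)) * (-1) ^ (j + 1))"
  have IH: "zeta_pE p v chi (1 - t) (of_nat (Suc m)) = chi (- 1) * (2 * S + (-1) ^ m * ell_pE p v chi (1 - t))"
    using Suc.IH by (simp only: S_def G_def)
  have "zeta_pE p v chi (1 - t) (of_nat (Suc m) + 1)
      = 2 * integrand (of_nat (Suc m)) - zeta_pE p v chi (1 - t) (of_nat (Suc m))"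
    using zeta_shift[OF of_nat_padic_ints[of "Suc m"]] unfolding eq_diff_eq .
  also have "\<dots> = chi (- 1) * (2 * (G (- int (Suc m)) - S) + (-1) ^ Suc m * ell_pE p v chi (1 - t))"
    unfolding IH F by (simp add: ring_distribs mult.left_commute del: of_nat_Suc)
  also have "of_nat (Suc m) + 1 = (of_nat (Suc (Suc m)) :: 'a)"
    by simp
  finally show ?case
    unfolding sum[folded S_def, symmetric] unfolding G_def .
qed

end

theorem theorem4p10:
  fixes p v :: nat
    and chi :: "int \<Rightarrow> 'a::{field_char_0,alg_closed_field,complete_space}"
    and s x :: 'a
  assumes "prime p" and "odd p"
    and "is_complex_padic p TYPE('a)"
    and "v \<ge> 1"
    and "dirichlet_character (p ^ v) chi"
    and "x \<in> padic_ints"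
    and "padic_abs s < padic_radius p"
  shows
    "(zeta_pE p v chi s (x + 1) + zeta_pE p v chi s x
       = 2 * character_ext (p ^ v) chi x * angle_power p x (1 - s)) \<and>
     (zeta_pE p v chi s (1 - x) = chi (-1) * zeta_pE p v chi s x) \<and>
     ((chi (-1) = 1 \<longrightarrow> ell_pE p v chi s = 0) \<and>
      (\<forall>n::nat. n > 0 \<longrightarrow>
        zeta_pE p v chi s (of_nat n) =
          chi (-1) *
            (2 * (\<Sum>j = 1..n - 1. angle_power p (of_int (int j - int n)) (1 - s)
                                     * chi (int j - int n) * (-1) ^ (j + 1))
             + (-1) ^ (n + 1) * ell_pE p v chi s))) \<and>
     (\<forall>N::nat. odd N \<and> \<not> p dvd N \<longrightarrow>
      (\<Sum>i = 0..N - 1. zeta_pE p v chi s (x + of_nat i / of_nat N) * (-1) ^ i)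
        = inverse (chi (int N)) * angle_power p (of_nat N) (s - 1) * zeta_pE p v chi s (of_nat N * x))"
proof -
  interpret padic_valued_field p "TYPE('a)"
    using assms(1,3) unfolding is_complex_padic_def by unfold_locales blast+
  \<comment> \<open>This bounds \<open>s\<close>, \<open>1 - s\<close> and \<open>s - 1\<close>
    alike and stays below the radius, which exceeds 1 because an odd prime is at least 3.\<close>
  define M where "M = max 1 (padic_abs s)"
  have "p \<ge> 3"
    using prime_ge_2_nat[OF assms(1)] assms(2) by (cases "p = 2") auto
  then have "padic_radius p > 1"
    unfolding padic_radius_def by (intro gr_one_powr) auto
  then have M: "M \<ge> 1" "M < padic_radius p"
    using assms(7) by (auto simp: M_def)
  have t_le: "padic_abs (1 - s) \<le> M"
    using pabs_diff[of 1 s] by (simp add: M_def)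
  interpret padic_character p "TYPE('a)" M v chi "1 - s"
    using M t_le assms by unfold_locales
  have s: "1 - (1 - s) = s" "- (1 - s) = s - 1"
    by simp_all
  have "(\<Sum>i = 0..N - 1. zeta_pE p v chi s (x + of_nat i / of_nat N) * (-1) ^ i)
        = inverse (chi (int N)) * angle_power p (of_nat N) (s - 1) * zeta_pE p v chi s (of_nat N * x)"
    if "odd N" "\<not> p dvd N" for N
  proof -
    \<comment> \<open>Positivity of \<open>N\<close>, from oddness, keeps the subtraction from
      truncating.\<close>
    have "{0..N - 1} = {..<N}"
      using odd_pos[OF that(1)] by auto
    then show ?thesis
      using zeta_distribution[OF assms(6) that] t_le unfolding s by (simp add: pabs_minus_commute)
  qed
  moreover have "zeta_pE p v chi s (of_nat n) =
          chi (-1) *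
            (2 * (\<Sum>j = 1..n - 1. angle_power p (of_int (int j - int n)) (1 - s)
                                     * chi (int j - int n) * (-1) ^ (j + 1))
             + (-1) ^ (n + 1) * ell_pE p v chi s)" if pos: "n > 0" for n
  proof -
    obtain m where "n = Suc m"
      using pos by (cases n) auto
    then show ?thesis
      using zeta_of_nat[of m] unfolding s by simp
  qed
  ultimately show ?thesis
    using zeta_shift[OF assms(6)] zeta_reflect[OF assms(6)] ell_pE_even
    unfolding s integrand_def by (simp add: mult.assoc)
qed

end
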